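(* For any function $\tilde C:(0,\infty)\to(0,\infty)$ and any $\alpha>0$, $2\le p\le\infty$, $1<q\le\infty$, there exists a constant $c>0$ (depending only on $\tilde C,\alpha,p,q$) such that for all integers $m\ge1$, all $\sigma>0$ and all $M\ge\sigma$, $$Q(\tilde S_0,\tilde C,\mathcal{B}^{\alpha}_{p,q}(M))\ \ge\ c\left(m^3+\left(\frac{M}{\sigma}\right)^{\frac{2}{2\alpha+1}}m^{\frac{2\alpha+2}{2\alpha+1}}\right),$$ where $\tilde S_0=\{(\alpha',M',p',q'):\alpha'>0,\ M'\ge\sigma,\ 2\le p'\le\infty,\ 1<q'\le\infty\}$ and $Q$ is the minimax communication cost for statistically-optimal adaptive estimators.
   Context: Distributed Gaussian sequence model: there are $m$ local machines; machine $i\in\{1,\dots,m\}$ observes only $X_i=(X_{i,jk})_{j\ge0,\,1\le k\le 2^j}$, where $X_{i,jk}=\theta_{jk}+\sigma z_{i,jk}$, the $z_{i,jk}$ are i.i.d. $N(0,1)$ over all $i,j,k$, $\sigma>0$ is known, and $\theta=(\theta_{jk})_{j\ge0,1\le k\le2^j}$ is the unknown real sequence. Besov ball: with $s=\alpha+1/2-1/p$, $\mathcal{B}^{\alpha}_{p,q}(M)=\{\theta:|\theta|_{b^{\alpha}_{p,q}}\le M\}$, where $|\theta|_{b^{\alpha}_{p,q}}=\Big(\sum_{j\ge0}\big(2^{js}(\sum_{k=1}^{2^j}|\theta_{jk}|^p)^{1/p}\big)^q\Big)^{1/q}$, with the usual replacement by suprema when $p=\infty$ or $q=\infty$. Distributed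 estimator: machine $i$ produces a transcript $Z_i=Z_i(X_i)$, a (possibly randomized, with randomization independent across machines) function of its own data $X_i$ only, taking values in a uniquely decodable set of finite binary strings of length at least $1$. The central machine outputs $\hat\theta=\hat\theta(Z_1,\dots,Z_m)$, a real sequence. $|Z_i|_l$ is the length (number of bits) of $Z_i$, and $L(\hat\theta)=\sum_{i=1}^m|Z_i|_l$ is the total communication cost. Also $\|\hat\theta-\theta\|^2=\sum_{j\ge0}\sum_{k=1}^{2^j}(\hat\theta_{jk}-\theta_{jk})^2$, and expectations are over the data and the randomization. Statistically-optimal adaptive estimators: for a set $\tilde S$ of parameter quadruples $(\alpha,M,p,q)$ and a function $\tilde C:(0,\infty)\to(0,\infty)$, $\mathcal{G}(\tilde S,\tilde C)$ is the set of distributed estimators $\hat\theta$ such that for every $(\alpha,M,p,q)\in\tilde S$, $$\sup_{\theta\in\mathcal{B}^{\alpha}_{p,q}(M)}\mathbb{E}\|\hat\theta-\theta\|^2\le\tilde C(\alpha)M^{\frac{2}{2\alpha+1}}\left(\frac{\sigma^2}{m}\right)^{\frac{2\alpha}{2\alpha+1}}.$$ The minimax communication cost is $Q(\tilde S,\tilde C,\mathcal{B}^{\alpha}_{p,q}(M))=\inf_{\hat\theta\in\mathcal{G}(\tilde S,\tilde C)}\sup_{\theta\in\mathcal{B}^{\alpha}_{p,q}(M)}\mathbb{E}_\theta L(\hat\theta)$, with the infimum over the empty set equal to $+\infty$. *)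

theory Defs
  imports "HOL-Probability.Probability"
begin

type_synonym coeffs = "nat \<Rightarrow> nat \<Rightarrow> real"

definition coeff_index :: "(nat \<times> nat) set" where
  "coeff_index = (SIGMA j:UNIV. {1..2 ^ j})"

text \<open>Exponents are extended reals, so that \<open>p = \<infinity>\<close> and \<open>q = \<infinity>\<close> are allowed; \<open>1 / \<infinity> = 0\<close>.\<close>

definition level_norm :: "ereal \<Rightarrow> coeffs \<Rightarrow> nat \<Rightarrow> real" where
  "level_norm p \<theta> j =
     (if p = \<infinity> then Max ((\<lambda>k. \<bar>\<theta> j k\<bar>) ` {1..2 ^ j})
      else (\<Sum>k = 1..2 ^ j. \<bar>\<theta> j k\<bar> powr real_of_ereal p) powr (1 / real_of_ereal p))"

definition besov_level :: "real \<Rightarrow> ereal \<Rightarrow> coeffs \<Rightarrow> nat \<Rightarrow> real" where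
  "besov_level \<alpha> p \<theta> j =
     2 powr (real j * (\<alpha> + 1 / 2 - real_of_ereal (1 / p))) * level_norm p \<theta> j"

definition besov_norm :: "real \<Rightarrow> ereal \<Rightarrow> ereal \<Rightarrow> coeffs \<Rightarrow> ereal" where
  "besov_norm \<alpha> p q \<theta> =
     (if q = \<infinity> then (SUP j. ereal (besov_level \<alpha> p \<theta> j))
      else if summable (\<lambda>j. besov_level \<alpha> p \<theta> j powr real_of_ereal q)
        then ereal ((\<Sum>j. besov_level \<alpha> p \<theta> j powr real_of_ereal q) powr (1 / real_of_ereal q))
      else \<infinity>)"

definition besov_ball :: "real \<Rightarrow> real \<Rightarrow> ereal \<Rightarrow> ereal \<Rightarrow> coeffs set" where
  "besov_ball \<alpha> M p q = {\<theta>. besov_norm \<alpha> p q \<theta> \<le> ereal M}"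

definition obs_space :: "(nat \<times> nat \<Rightarrow> real) measure" where
  "obs_space = (\<Pi>\<^sub>M jk\<in>coeff_index. borel)"

definition obs_law :: "real \<Rightarrow> coeffs \<Rightarrow> (nat \<times> nat \<Rightarrow> real) measure" where
  "obs_law \<sigma> \<theta> =
     (\<Pi>\<^sub>M jk\<in>coeff_index. density lborel (normal_density (\<theta> (fst jk) (snd jk)) \<sigma>))"

definition uniquely_decodable :: "'a list set \<Rightarrow> bool" where
  "uniquely_decodable W \<longleftrightarrow> inj_on concat (lists W)"

text \<open>The randomized transcript of machine \<open>i\<close> is given by its conditional law
  \<open>encoder e i x\<close> given the local observation \<open>x\<close>.\<close>

record dist_estimator =
  encoder :: "nat \<Rightarrow> (nat \<times> nat \<Rightarrow> real) \<Rightarrow> bool list pmf"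
  decoder :: "(nat \<Rightarrow> bool list) \<Rightarrow> coeffs"

definition dist_estimators :: "nat \<Rightarrow> dist_estimator set" where
  "dist_estimators m = {e. \<forall>i\<in>{1..m}.
     (\<lambda>x. measure_pmf (encoder e i x)) \<in> obs_space \<rightarrow>\<^sub>M prob_algebra (count_space UNIV) \<and>
     (\<exists>W. uniquely_decodable W \<and> (\<forall>w\<in>W. 1 \<le> length w) \<and>
          (\<forall>x\<in>space obs_space. set_pmf (encoder e i x) \<subseteq> W))}"

text \<open>Observations and private randomization are independent across machines, so the joint law of
  \<open>(Z\<^sub>1, \<dots>, Z\<^sub>m)\<close> is the product of the marginal laws.\<close>

definition transcripts_law ::
    "nat \<Rightarrow> real \<Rightarrow> dist_estimator \<Rightarrow> coeffs \<Rightarrow> (nat \<Rightarrow> bool list) measure" where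
  "transcripts_law m \<sigma> e \<theta> =
     (\<Pi>\<^sub>M i\<in>{1..m}. obs_law \<sigma> \<theta> \<bind> (\<lambda>x. measure_pmf (encoder e i x)))"

definition sq_loss :: "coeffs \<Rightarrow> coeffs \<Rightarrow> ennreal" where
  "sq_loss \<theta>' \<theta> = (\<Sum>j. ennreal (\<Sum>k = 1..2 ^ j. (\<theta>' j k - \<theta> j k)\<^sup>2))"

definition risk :: "nat \<Rightarrow> real \<Rightarrow> dist_estimator \<Rightarrow> coeffs \<Rightarrow> ennreal" where
  "risk m \<sigma> e \<theta> = (\<integral>\<^sup>+ z. sq_loss (decoder e z) \<theta> \<partial>transcripts_law m \<sigma> e \<theta>)"

definition expected_cost :: "nat \<Rightarrow> real \<Rightarrow> dist_estimator \<Rightarrow> coeffs \<Rightarrow> ennreal" where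
  "expected_cost m \<sigma> e \<theta> =
     (\<integral>\<^sup>+ z. of_nat (\<Sum>i = 1..m. length (z i)) \<partial>transcripts_law m \<sigma> e \<theta>)"

definition adaptive_estimators ::
    "nat \<Rightarrow> real \<Rightarrow> (real \<times> real \<times> ereal \<times> ereal) set \<Rightarrow> (real \<Rightarrow> real) \<Rightarrow> dist_estimator set" where
  "adaptive_estimators m \<sigma> S C = {e \<in> dist_estimators m.
     \<forall>(\<alpha>, M, p, q)\<in>S. (SUP \<theta>\<in>besov_ball \<alpha> M p q. risk m \<sigma> e \<theta>)
       \<le> ennreal (C \<alpha> * M powr (2 / (2 * \<alpha> + 1))
                    * (\<sigma>\<^sup>2 / real m) powr (2 * \<alpha> / (2 * \<alpha> + 1)))}"

text \<open>In \<open>ennreal\<close> the infimum of the empty set is \<open>\<infinity>\<close>.\<close>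

definition minimax_cost ::
    "nat \<Rightarrow> real \<Rightarrow> (real \<times> real \<times> ereal \<times> ereal) set \<Rightarrow> (real \<Rightarrow> real) \<Rightarrow> coeffs set \<Rightarrow> ennreal" where
  "minimax_cost m \<sigma> S C B =
     (INF e\<in>adaptive_estimators m \<sigma> S C. SUP \<theta>\<in>B. expected_cost m \<sigma> e \<theta>)"

definition full_parameter_set :: "real \<Rightarrow> (real \<times> real \<times> ereal \<times> ereal) set" where
  "full_parameter_set \<sigma> = {(\<alpha>, M, p, q). 0 < \<alpha> \<and> \<sigma> \<le> M \<and> 2 \<le> p \<and> 1 < q}"

end

theory Submission
  imports Defs
begin

text \<open>
  The lower bound has two summands, and both come from the same cube of parameters. At level \<open>J\<close>,
  with \<open>D = 2 ^ J\<close> coefficients, let every coefficient be \<open>a\<close> or \<open>- a\<close>, where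
  \<open>a = \<delta> * \<sigma> / sqrt m\<close>, and let all other levels vanish. The constant \<open>\<delta>\<close> is chosen so large,
  depending on \<open>C \<alpha>\<close> and \<open>\<alpha>\<close>, that a risk within the adaptive budget is at most
  half of \<open>a\<^sup>2 * D\<close>: the estimator has to determine a constant fraction of the signs.

  \<^bold>\<open>Signs cost bits.\<close> Flipping one sign changes the law of the transcripts of all machines. A small
  risk forces the total squared Hellinger distance between neighbouring corners, summed over
  coordinates and machines and averaged over the corners, to be at least of order \<open>D\<close>
  (\<open>two_point_risk_bound\<close>, which uses that the transcripts are independent). On the other hand, a message \<open>z\<close>
  of probability \<open>p z\<close> contributes at most a multiple of \<open>(a / \<sigma>)\<^sup>2 * p z * ln (1 / p z)\<close>
  to the sum over all coordinates, because conditioning on an event of probability \<open>p z\<close>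
  can shift independent sub-Gaussian scores only by a vector of squared length of order \<open>ln (1 / p z)\<close>
  (\<open>posterior_score_bound\<close>). The transcripts shorter than \<open>T\<close> bits are fewer than
  \<open>2 ^ T\<close>, so together they contribute order \<open>(a / \<sigma>)\<^sup>2 * T\<close>; the longer ones are controlled by their
  probability (\<open>message_information_bound\<close>). With \<open>m\<close> machines and \<open>(a / \<sigma>)\<^sup>2 = \<delta>\<^sup>2 / m\<close>, taking
  \<open>T\<close> to be a small multiple of \<open>D\<close> shows that on average over the corners a constant fraction of the machines sends
  at least \<open>T\<close> bits with probability bounded below (\<open>long_transcripts\<close>). The total cost is then of order \<open>m * D\<close>.

  \<^bold>\<open>Transmission.\<close> The largest cube inside the given Besov ball has
  \<open>D\<close> of order \<open>((M / \<sigma>)\<^sup>2 * m) powr (1 / (2 * \<alpha> + 1))\<close>, and \<open>m * D\<close> is the second summand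
  (\<open>transmission_cost\<close>).

  \<^bold>\<open>Adaptation.\<close> Take \<open>D\<close> to be a small multiple of \<open>m\<^sup>2\<close>. This cube may lie far outside the given ball, but it lies in
  a ball with the same smoothness and another radius, on which the estimator is accurate as well.
  For one machine the uniform mixture over the corners
  is close to the zero signal: the chi-square distance is at most \<open>exp (D * \<delta> ^ 4 / m\<^sup>2) - 1\<close>
  (\<open>mixture_long_prob_le\<close>). Hence the machines must send long
  transcripts even if the true parameter is zero, which belongs to every ball, and the cost there is of order
  \<open>m * D\<close>, that is \<open>m ^ 3\<close> (\<open>adaptation_cost\<close>). Where no admissible cube is large enough,
  the bound of one bit per machine suffices.
\<close>

section \<open>Product measures that differ in finitely many factors\<close>

lemma (in product_prob_space) nn_integral_PiM_prod_subset:
  assumes F: "finite F" "F \<subseteq> I" and f: "\<And>i. i \<in> F \<Longrightarrow> f i \<in> borel_measurable (M i)"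
  shows "(\<integral>\<^sup>+x. (\<Prod>i\<in>F. f i (x i)) \<partial>PiM I M) = (\<Prod>i\<in>F. integral\<^sup>N (M i) (f i))"
proof -
  have "(\<integral>\<^sup>+x. (\<Prod>i\<in>F. f i (x i)) \<partial>PiM I M) = (\<integral>\<^sup>+x. (\<Prod>i\<in>F. f i (restrict x F i)) \<partial>PiM I M)"
    by (intro nn_integral_cong prod.cong) auto
  also have "\<dots> = (\<integral>\<^sup>+x. (\<Prod>i\<in>F. f i (x i)) \<partial>distr (PiM I M) (PiM F M) (\<lambda>x. restrict x F))"
    using F f by (subst nn_integral_distr)
      (auto intro!: measurable_restrict_subset borel_measurable_prod_ennreal measurable_compose[OF measurable_component_singleton])
  also have "\<dots> = (\<integral>\<^sup>+x. (\<Prod>i\<in>F. f i (x i)) \<partial>PiM F M)"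
    by (simp add: distr_PiM_restrict_finite[OF F])
  also have "\<dots> = (\<Prod>i\<in>F. integral\<^sup>N (M i) (f i))"
    by (intro product_nn_integral_prod F f)
  finally show ?thesis .
qed

text \<open>The index set may be infinite, so the product of all the densities need not make sense; with finitely many
  changed factors the cylinder sets reduce the claim to a finite product.\<close>
lemma (in product_prob_space) PiM_density_finite:
  assumes F: "finite F" "F \<subseteq> I" and g: "\<And>i. i \<in> F \<Longrightarrow> g i \<in> borel_measurable (M i)"
    and N: "\<And>i. prob_space (N i)"
    and dens: "\<And>i. i \<in> F \<Longrightarrow> N i = density (M i) (g i)" and same: "\<And>i. i \<in> I - F \<Longrightarrow> N i = M i"
  shows "PiM I N = density (PiM I M) (\<lambda>x. \<Prod>i\<in>F. g i (x i))"
proof -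
  interpret N: prob_space "N i" for i by (rule N)
  interpret N: product_prob_space N I by unfold_locales
  have setsN: "sets (N i) = sets (M i)" if "i \<in> I" for i
    using that dens same by (cases "i \<in> F") auto
  have spaceN: "space (N i) = space (M i)" if "i \<in> I" for i
    using setsN[OF that] by (rule sets_eq_imp_space_eq)
  have meas: "(\<lambda>x. \<Prod>i\<in>F. g i (x i)) \<in> borel_measurable (PiM I M)"
    using F g by (auto intro!: borel_measurable_prod_ennreal measurable_compose[OF measurable_component_singleton])
  show ?thesis
  proof (rule N.PiM_eq[symmetric])
    show "sets (density (PiM I M) (\<lambda>x. \<Prod>i\<in>F. g i (x i))) = sets (PiM I N)"
      by (simp, rule sets_PiM_cong) (auto simp: setsN)
  next
    fix J A assume J: "finite J" "J \<subseteq> I" and A: "\<And>j. j \<in> J \<Longrightarrow> A j \<in> sets (N j)"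
    have A': "A j \<in> sets (M j)" if "j \<in> J" for j using A[OF that] setsN J that by auto
    let ?X = "prod_emb I N J (PiE J A)"
    let ?h = "\<lambda>i y. (if i \<in> F then g i y else 1) * (if i \<in> J then indicator (A i) y else 1)"
    have X: "?X = prod_emb I M J (PiE J A)"
      unfolding prod_emb_def by (intro arg_cong2[where f="(\<inter>)"] refl PiE_cong) (auto simp: spaceN)
    have XM: "?X \<in> sets (PiM I M)"
      unfolding X by (rule sets_PiM_I[OF J]) (auto simp: A')
    have "emeasure (density (PiM I M) (\<lambda>x. \<Prod>i\<in>F. g i (x i))) ?X
       = (\<integral>\<^sup>+x. (\<Prod>i\<in>F. g i (x i)) * indicator ?X x \<partial>PiM I M)"
      by (rule emeasure_density[OF meas XM])
    also have "\<dots> = (\<integral>\<^sup>+x. (\<Prod>i\<in>F \<union> J. ?h i (x i)) \<partial>PiM I M)"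
    proof (rule nn_integral_cong)
      fix x assume x: "x \<in> space (PiM I M)"
      have 1: "indicator ?X x = (\<Prod>i\<in>J. indicator (A i) (x i) :: ennreal)"
      proof (cases "\<forall>i\<in>J. x i \<in> A i")
        case True
        then have "x \<in> ?X" unfolding X using x J by (auto simp: prod_emb_def space_PiM)
        with True show ?thesis by simp
      next
        case False
        then have "x \<notin> ?X" unfolding X by (auto simp: prod_emb_def)
        moreover obtain i where "i \<in> J" "x i \<notin> A i" using False by auto
        then have "(\<Prod>i\<in>J. indicator (A i) (x i) :: ennreal) = 0" using J by (intro prod_zero bexI[of _ i]) auto
        ultimately show ?thesis by simp
      qed
      have "(\<Prod>i\<in>F \<union> J. ?h i (x i)) = (\<Prod>i\<in>F \<union> J. if i \<in> F then g i (x i) else 1) *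
        (\<Prod>i\<in>F \<union> J. if i \<in> J then indicator (A i) (x i) else 1)"
        by (rule prod.distrib)
      also have "(\<Prod>i\<in>F \<union> J. if i \<in> F then g i (x i) else 1) = (\<Prod>i\<in>F. g i (x i))"
        using F J by (intro prod.mono_neutral_cong_right) auto
      also have "(\<Prod>i\<in>F \<union> J. if i \<in> J then indicator (A i) (x i) else 1) = (\<Prod>i\<in>J. indicator (A i) (x i) :: ennreal)"
        using F J by (intro prod.mono_neutral_cong_right) auto
      finally show "(\<Prod>i\<in>F. g i (x i)) * indicator ?X x = (\<Prod>i\<in>F \<union> J. ?h i (x i))" using 1 by simp
    qed
    also have "\<dots> = (\<Prod>i\<in>F \<union> J. integral\<^sup>N (M i) (?h i))"
    proof (rule nn_integral_PiM_prod_subset)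
      fix i assume "i \<in> F \<union> J"
      then show "?h i \<in> borel_measurable (M i)"
        using g[of i] A'[of i] by (cases "i \<in> F"; cases "i \<in> J") auto
    qed (use F J in auto)
    also have "\<dots> = (\<Prod>i\<in>F \<union> J. if i \<in> J then emeasure (N i) (A i) else 1)"
    proof (rule prod.cong[OF refl])
      fix i assume i: "i \<in> F \<union> J"
      then have iI: "i \<in> I" using F J by auto
      have "emeasure (N i) (space (M i)) = 1" using prob_space.emeasure_space_1[OF N[of i]] spaceN[OF iI] by simp
      then show "integral\<^sup>N (M i) (?h i) = (if i \<in> J then emeasure (N i) (A i) else 1)"
        using i A'[of i] g[of i] dens[of i] same[of i] iI
        by (cases "i \<in> F"; cases "i \<in> J") (simp_all add: emeasure_density cong: nn_integral_cong)
    qed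
    also have "\<dots> = (\<Prod>j\<in>J. emeasure (N j) (A j))"
      using F J by (intro prod.mono_neutral_cong_right) auto
    finally show "emeasure (density (PiM I M) (\<lambda>x. \<Prod>i\<in>F. g i (x i))) ?X = (\<Prod>j\<in>J. emeasure (N j) (A j))" .
  qed
qed

section \<open>Information about a high-dimensional parameter in one message\<close>

text \<open>Under the law with density \<open>g / p\<close> the score vector \<open>W\<close> has a mean whose positive part is bounded by the
  entropy cost \<open>ln (1 / p)\<close> of the conditioning. This is the Gibbs variational principle: Jensen's inequality gives
  \<open>exp (E [c \<bullet> W | g]) \<le> E [g * exp (c \<bullet> W)] / p \<le> exp (V * c \<bullet> c) / p\<close>, and \<open>c\<close> is then optimized. Only
  nonnegative \<open>c\<close> occur, which matters because the scores used below are bounded above but have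
  a log-normal tail below.\<close>
lemma (in prob_space) posterior_score_bound:
  fixes W :: "'i \<Rightarrow> 'a \<Rightarrow> real" and g :: "'a \<Rightarrow> real"
  assumes K: "finite K"
    and W: "\<And>k. k \<in> K \<Longrightarrow> W k \<in> borel_measurable M" 
    and int: "\<And>k. k \<in> K \<Longrightarrow> integrable M (\<lambda>x. g x * W k x)"
    and g: "g \<in> borel_measurable M" "\<And>x. 0 \<le> g x" "\<And>x. g x \<le> 1"
    and V: "0 < V"
    and subg: "\<And>c. (\<And>k. k \<in> K \<Longrightarrow> 0 \<le> c k) \<Longrightarrow>
      (\<integral>\<^sup>+x. ennreal (exp (\<Sum>k\<in>K. c k * W k x)) \<partial>M) \<le> ennreal (exp (V * (\<Sum>k\<in>K. (c k)\<^sup>2)))"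
    and p: "p = expectation g" "0 < p"
  shows "(\<Sum>k\<in>K. (max 0 (expectation (\<lambda>x. g x * W k x) / p))\<^sup>2) \<le> 4 * V * ln (1 / p)"
proof -
  define w where "w k = expectation (\<lambda>x. g x * W k x) / p" for k
  \<comment> \<open>The maximizer of \<open>c * w - V * c\<^sup>2\<close> over \<open>c \<ge> 0\<close>.\<close>
  define c where "c k = max 0 (w k) / (2 * V)" for k
  define Y where "Y x = (\<Sum>k\<in>K. c k * W k x)" for x
  define y where "y = (\<Sum>k\<in>K. c k * w k)"
  define E where "E = exp (V * (\<Sum>k\<in>K. (c k)\<^sup>2))"
  have c0: "0 \<le> c k" for k using V by (simp add: c_def)
  have Ym: "Y \<in> borel_measurable M" unfolding Y_def using W by auto
  have le: "(\<integral>\<^sup>+x. ennreal (exp (Y x)) \<partial>M) \<le> ennreal E"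
    unfolding Y_def E_def using c0 by (intro subg) auto
  have iexp: "integrable M (\<lambda>x. exp (Y x))"
    using Ym le by (intro integrableI_nonneg) (auto simp: le_less_trans)
  have Eexp: "expectation (\<lambda>x. exp (Y x)) \<le> E"
    using le Ym by (subst integral_eq_nn_integral) (auto intro!: enn2real_leI simp: E_def)
  have igexp: "integrable M (\<lambda>x. g x * exp (Y x))"
    using g Ym by (intro Bochner_Integration.integrable_bound[OF iexp]) (auto simp: mult_le_cancel_right1)
  have ig: "integrable M g" using g by (intro integrable_const_bound[of _ 1]) auto
  have igY: "integrable M (\<lambda>x. g x * Y x)" "expectation (\<lambda>x. g x * Y x) = p * y"
  proof -
    have eq: "(\<lambda>x. g x * Y x) = (\<lambda>x. \<Sum>k\<in>K. c k * (g x * W k x))"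
      by (auto simp: Y_def sum_distrib_left mult_ac)
    show "integrable M (\<lambda>x. g x * Y x)" unfolding eq using int by auto
    have "expectation (\<lambda>x. g x * Y x) = (\<Sum>k\<in>K. c k * expectation (\<lambda>x. g x * W k x))"
      unfolding eq using int by (subst Bochner_Integration.integral_sum) auto
    also have "\<dots> = p * y" using p(2) by (simp add: y_def w_def sum_distrib_left)
    finally show "expectation (\<lambda>x. g x * Y x) = p * y" .
  qed
  \<comment> \<open>Jensen's inequality through the tangent of the exponential at the conditional mean \<open>y\<close> of \<open>Y\<close>.\<close>
  have "exp y * p = expectation (\<lambda>x. exp y * (g x * (1 - y) + g x * Y x))"
    using igY ig by (simp add: p(1)[symmetric] algebra_simps)
  also have "\<dots> \<le> expectation (\<lambda>x. g x * exp (Y x))"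
  proof (rule integral_mono)
    fix x
    have "exp y * (1 + (Y x - y)) \<le> exp y * exp (Y x - y)"
      by (intro mult_left_mono) auto
    also have "\<dots> = exp (Y x)" by (simp add: exp_add[symmetric])
    finally have "g x * (exp y * (1 + (Y x - y))) \<le> g x * exp (Y x)"
      using g by (intro mult_left_mono) auto
    then show "exp y * (g x * (1 - y) + g x * Y x) \<le> g x * exp (Y x)"
      by (simp add: algebra_simps)
  qed (use igY ig igexp in auto)
  also have "\<dots> \<le> expectation (\<lambda>x. exp (Y x))"
    using g by (intro integral_mono igexp iexp) (auto simp: mult_le_cancel_right1)
  finally have "exp y * p \<le> E" using Eexp by simp
  then have "ln (exp y * p) \<le> ln E" using p(2) by (subst ln_le_cancel_iff) (auto simp: E_def)
  then have 1: "y \<le> V * (\<Sum>k\<in>K. (c k)\<^sup>2) + ln (1 / p)"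
    using p(2) by (simp add: ln_mult ln_div E_def)
  define s where "s = (\<Sum>k\<in>K. (max 0 (w k))\<^sup>2)"
  have "y = s / (2 * V)"
    unfolding y_def s_def sum_divide_distrib
    by (intro sum.cong) (auto simp: c_def max_def power2_eq_square)
  moreover have "V * (\<Sum>k\<in>K. (c k)\<^sup>2) = s / (4 * V)"
    using V unfolding s_def sum_divide_distrib sum_distrib_left
    by (intro sum.cong) (auto simp: c_def power2_eq_square)
  ultimately have "s / (2 * V) \<le> s / (4 * V) + ln (1 / p)" using 1 by simp
  then have "s \<le> 4 * V * ln (1 / p)" using V by (simp add: field_simps)
  then show ?thesis by (simp add: s_def w_def)
qed

lemma hellinger_pos_part_le:
  fixes p q :: real assumes p: "0 < p" and q: "0 \<le> q"
  shows "(max 0 (sqrt p - sqrt q))\<^sup>2 \<le> p * (max 0 ((p - q) / p))\<^sup>2"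
proof (cases "q \<le> p")
  case False
  then show ?thesis using p by (simp add: max_def not_le)
next
  case True
  define u v where "u = sqrt p" and "v = sqrt q"
  have uv: "0 < u" "0 \<le> v" "v \<le> u" "p = u\<^sup>2" "q = v\<^sup>2"
    using p q True by (auto simp: u_def v_def)
  have "u * (u - v) \<le> p - q"
    using mult_right_mono[OF uv(3,2)] unfolding uv(4,5) by (simp add: power2_eq_square algebra_simps)
  then have "(u * (u - v))\<^sup>2 \<le> (p - q)\<^sup>2" using uv by (intro power_mono) auto
  then have "(u - v)\<^sup>2 * p \<le> (p - q)\<^sup>2"
    by (simp add: uv(4) power_mult_distrib mult.commute)
  then have "(u - v)\<^sup>2 \<le> (p - q)\<^sup>2 / p"
    using p by (simp add: pos_le_divide_eq)
  also have "\<dots> = p * ((p - q) / p)\<^sup>2"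
    using p by (simp add: power_divide power2_eq_square)
  finally have "(u - v)\<^sup>2 \<le> p * ((p - q) / p)\<^sup>2" .
  then show ?thesis using True p uv by (simp add: u_def[symmetric] v_def[symmetric] max_def)
qed

text \<open>Summed over at most \<open>N\<close> messages this bounds their entropy by \<open>ln N + 1\<close>, even
  when the messages carry only part of the total mass.\<close>
lemma neg_entropy_term_le:
  fixes p N :: real assumes "0 < p" "1 \<le> N"
  shows "p * ln (1 / p) \<le> p * ln N + 1 / N"
proof -
  have "ln (1 / (p * N)) \<le> 1 / (p * N) - 1" using assms by (intro ln_le_minus_one) auto
  then have "p * ln (1 / (p * N)) \<le> p * (1 / (p * N) - 1)"
    using assms by (intro mult_left_mono) auto
  moreover have "ln (1 / (p * N)) = ln (1 / p) - ln N"
    using assms by (simp add: ln_mult ln_div)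
  moreover have "p * (1 / (p * N) - 1) = 1 / N - p"
    using assms by (simp add: field_simps)
  ultimately have "p * (ln (1 / p) - ln N) \<le> 1 / N - p" by simp
  then show ?thesis using assms(1) unfolding right_diff_distrib by linarith
qed

text \<open>Here \<open>W k\<close> is one minus the likelihood ratio of the \<open>k\<close>-th alternative, so \<open>p\<close> and \<open>q k\<close> are the laws of the message
  under the base law and under that alternative. One-sided distances suffice, since the opposite sides
  appear when the roles of two neighbouring hypotheses are exchanged, and they need only nonnegative
  combinations of the scores \<open>W k\<close>. The messages in \<open>A\<close> are charged through their entropy; for the remaining ones, of which there may be
  infinitely many with unbounded entropy, Jensen's inequality bounds the contribution by the second moment of \<open>W k\<close> on the event that such a
  message is sent, which the fourth moment and the probability of this event control.\<close>
lemma (in prob_space) message_information_bound: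
  fixes W :: "'i \<Rightarrow> 'a \<Rightarrow> real" and \<kappa> :: "'a \<Rightarrow> 'z::countable pmf"
  assumes K: "finite K"
    and W: "\<And>k. k \<in> K \<Longrightarrow> W k \<in> borel_measurable M" "\<And>k x. k \<in> K \<Longrightarrow> W k x \<le> 1"
    and \<kappa>: "\<And>z. (\<lambda>x. pmf (\<kappa> x) z) \<in> borel_measurable M"
    and V: "0 < V"
    and subg: "\<And>c. (\<And>k. k \<in> K \<Longrightarrow> 0 \<le> c k) \<Longrightarrow>
      (\<integral>\<^sup>+x. ennreal (exp (\<Sum>k\<in>K. c k * W k x)) \<partial>M) \<le> ennreal (exp (V * (\<Sum>k\<in>K. (c k)\<^sup>2)))"
    and F: "0 \<le> F" "\<And>k. k \<in> K \<Longrightarrow> (\<integral>\<^sup>+x. ennreal (W k x ^ 4) \<partial>M) \<le> ennreal F"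
    and A: "finite A" "real (card A) \<le> N" "1 \<le> N"
    and l: "0 < l"
    and p: "\<And>z. p z = expectation (\<lambda>x. pmf (\<kappa> x) z)"
    and q: "\<And>k z. k \<in> K \<Longrightarrow> q k z = expectation (\<lambda>x. pmf (\<kappa> x) z * (1 - W k x))"
    and P: "0 \<le> P" "(\<integral>\<^sup>+z. ennreal (p z) * indicator (- A) z \<partial>count_space UNIV) \<le> ennreal P"
  shows "(\<integral>\<^sup>+z. ennreal (\<Sum>k\<in>K. (max 0 (sqrt (p z) - sqrt (q k z)))\<^sup>2) \<partial>count_space UNIV)
    \<le> ennreal (4 * V * (ln N + 1) + real (card K) * (l * P + F / (4 * l)))"
proof -
  let ?h = "\<lambda>k z. (max 0 (sqrt (p z) - sqrt (q k z)))\<^sup>2"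
  have i\<kappa>: "integrable M (\<lambda>x. pmf (\<kappa> x) z)" for z
    using \<kappa> by (intro integrable_const_bound[of _ 1]) (auto simp: pmf_le_1)
  have p0: "0 \<le> p z" for z unfolding p by simp
  have q0: "0 \<le> q k z" if "k \<in> K" for k z
    unfolding q[OF that] using W(2)[OF that] by (intro integral_nonneg_AE) auto
  have iW4: "integrable M (\<lambda>x. W k x ^ 4)" if "k \<in> K" for k
    using F(2)[OF that] W(1)[OF that] by (intro integrableI_nonneg) (auto simp: le_less_trans)
  have i\<kappa>W4: "integrable M (\<lambda>x. pmf (\<kappa> x) z * W k x ^ 4)" if "k \<in> K" for k z
    using W(1)[OF that] \<kappa> by (intro Bochner_Integration.integrable_bound[OF iW4[OF that]])
      (auto simp: mult_left_le_one_le pmf_le_1)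
  have iW: "integrable M (W k)" if "k \<in> K" for k
  proof (rule Bochner_Integration.integrable_bound)
    show "integrable M (\<lambda>x. 1 + W k x ^ 4)" using iW4[OF that] by auto
    have "\<bar>y\<bar> \<le> 1 + y ^ 4" for y :: real
    proof (cases "\<bar>y\<bar> \<le> 1")
      case True then show ?thesis by (smt (verit) zero_le_even_power even_numeral)
    next
      case False
      then have "\<bar>y\<bar> ^ 1 \<le> \<bar>y\<bar> ^ 4" by (intro power_increasing) auto
      then show ?thesis by simp
    qed
    then show "AE x in M. norm (W k x) \<le> norm (1 + W k x ^ 4)" by (auto intro: order_trans)
  qed (use W that in auto)
  have i\<kappa>W: "integrable M (\<lambda>x. pmf (\<kappa> x) z * W k x)" if "k \<in> K" for k z
    using W(1)[OF that] \<kappa> by (intro Bochner_Integration.integrable_bound[OF iW[OF that]])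
      (auto simp: abs_mult mult_left_le_one_le pmf_le_1)
  have w: "expectation (\<lambda>x. pmf (\<kappa> x) z * W k x) = p z - q k z" if "k \<in> K" for k z
    unfolding p q[OF that] using i\<kappa> i\<kappa>W[OF that] by (simp add: algebra_simps)
  have sum_p: "(\<integral>\<^sup>+z. ennreal (p z) \<partial>count_space UNIV) = 1"
  proof -
    have "(\<integral>\<^sup>+z. ennreal (p z) \<partial>count_space UNIV) = (\<integral>\<^sup>+z. \<integral>\<^sup>+x. ennreal (pmf (\<kappa> x) z) \<partial>M \<partial>count_space UNIV)"
      unfolding p using i\<kappa> by (subst nn_integral_eq_integral) auto
    also have "\<dots> = (\<integral>\<^sup>+x. \<integral>\<^sup>+z. ennreal (pmf (\<kappa> x) z) \<partial>count_space UNIV \<partial>M)"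
      using \<kappa> by (intro nn_integral_count_space_nn_integral[symmetric]) auto
    finally show ?thesis by (simp add: nn_integral_pmf emeasure_space_1)
  qed
  have on_A: "(\<Sum>k\<in>K. ?h k z) \<le> 4 * V * (p z * ln N + 1 / N)" for z
  proof (cases "p z = 0")
    case True
    have "?h k z = 0" if "k \<in> K" for k using True q0[OF that, of z] by simp
    then have "(\<Sum>k\<in>K. ?h k z) = 0" by simp
    then show ?thesis using True V A by simp
  next
    case False
    then have pz: "0 < p z" using p0[of z] by simp
    have "(\<Sum>k\<in>K. ?h k z) \<le> (\<Sum>k\<in>K. p z * (max 0 ((p z - q k z) / p z))\<^sup>2)"
      using pz q0 by (intro sum_mono hellinger_pos_part_le) auto
    also have "\<dots> = p z * (\<Sum>k\<in>K. (max 0 (expectation (\<lambda>x. pmf (\<kappa> x) z * W k x) / p z))\<^sup>2)"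
      by (simp add: sum_distrib_left w)
    also have "\<dots> \<le> p z * (4 * V * ln (1 / p z))"
      using pz i\<kappa>W W(1) \<kappa> K V subg p by (intro mult_left_mono posterior_score_bound) (auto simp: pmf_le_1)
    also have "\<dots> = 4 * V * (p z * ln (1 / p z))" by simp
    also have "\<dots> \<le> 4 * V * (p z * ln N + 1 / N)"
      using pz A V by (intro mult_left_mono neg_entropy_term_le) auto
    finally show ?thesis .
  qed
  have off_A: "?h k z \<le> l * p z + expectation (\<lambda>x. pmf (\<kappa> x) z * W k x ^ 4) / (4 * l)" if k: "k \<in> K" for k z
  proof (cases "p z = 0")
    case True
    have "?h k z = 0" using True q0[OF k, of z] by simp
    moreover have "0 \<le> expectation (\<lambda>x. pmf (\<kappa> x) z * W k x ^ 4) / (4 * l)" using l by simp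
    ultimately show ?thesis using True by simp
  next
    case False
    then have pz: "0 < p z" using p0[of z] by simp
    define v where "v = (p z - q k z) / p z"
    have pt: "2 * v * y - v\<^sup>2 \<le> l + y ^ 4 / (4 * l)" for y
    proof -
      have "0 \<le> (y - v)\<^sup>2 + (2 * l - y\<^sup>2)\<^sup>2 / (4 * l)" using l by simp
      also have "\<dots> = (y - v)\<^sup>2 + (l - y\<^sup>2 + y ^ 4 / (4 * l))"
        using l by (simp add: field_simps power2_eq_square power4_eq_xxxx)
      finally show ?thesis by (simp add: power2_eq_square algebra_simps)
    qed
    have "?h k z \<le> p z * (max 0 v)\<^sup>2" unfolding v_def using pz q0[OF k] by (intro hellinger_pos_part_le)
    also have "\<dots> \<le> p z * v\<^sup>2" using pz by (intro mult_left_mono) (auto simp: max_def)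
    also have "\<dots> = 2 * v * expectation (\<lambda>x. pmf (\<kappa> x) z * W k x) - v\<^sup>2 * p z"
      unfolding w[OF k] using pz by (simp add: v_def field_simps power2_eq_square)
    also have "\<dots> = expectation (\<lambda>x. 2 * v * (pmf (\<kappa> x) z * W k x) - v\<^sup>2 * pmf (\<kappa> x) z)"
      using i\<kappa> i\<kappa>W[OF k] by (simp add: p)
    also have "\<dots> \<le> expectation (\<lambda>x. l * pmf (\<kappa> x) z + pmf (\<kappa> x) z * W k x ^ 4 / (4 * l))"
    proof (rule integral_mono)
      fix x
      show "2 * v * (pmf (\<kappa> x) z * W k x) - v\<^sup>2 * pmf (\<kappa> x) z \<le> l * pmf (\<kappa> x) z + pmf (\<kappa> x) z * W k x ^ 4 / (4 * l)"
        using mult_left_mono[OF pt[of "W k x"], of "pmf (\<kappa> x) z"] by (simp add: algebra_simps)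
    qed (use i\<kappa> i\<kappa>W[OF k] i\<kappa>W4[OF k] in auto)
    also have "\<dots> = l * p z + expectation (\<lambda>x. pmf (\<kappa> x) z * W k x ^ 4) / (4 * l)"
      using i\<kappa> i\<kappa>W4[OF k] by (simp add: p)
    finally show ?thesis .
  qed
  have "(\<integral>\<^sup>+z. ennreal (\<Sum>k\<in>K. ?h k z) \<partial>count_space UNIV)
      = (\<integral>\<^sup>+z. ennreal (\<Sum>k\<in>K. ?h k z) * indicator A z + ennreal (\<Sum>k\<in>K. ?h k z) * indicator (- A) z \<partial>count_space UNIV)"
    by (intro nn_integral_cong) (auto simp: indicator_def)
  also have "\<dots> = (\<integral>\<^sup>+z. ennreal (\<Sum>k\<in>K. ?h k z) * indicator A z \<partial>count_space UNIV)
      + (\<integral>\<^sup>+z. ennreal (\<Sum>k\<in>K. ?h k z) * indicator (- A) z \<partial>count_space UNIV)"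
    by (intro nn_integral_add) auto
  also have "(\<integral>\<^sup>+z. ennreal (\<Sum>k\<in>K. ?h k z) * indicator A z \<partial>count_space UNIV) \<le> ennreal (4 * V * (ln N + 1))"
  proof -
    have "(\<integral>\<^sup>+z. ennreal (\<Sum>k\<in>K. ?h k z) * indicator A z \<partial>count_space UNIV) = (\<Sum>z\<in>A. ennreal (\<Sum>k\<in>K. ?h k z))"
      using A(1) by (subst nn_integral_count_space'[of A]) (auto intro!: sum.cong)
    also have "\<dots> = ennreal (\<Sum>z\<in>A. \<Sum>k\<in>K. ?h k z)" by (intro sum_ennreal) (auto intro: sum_nonneg)
    also have "\<dots> \<le> ennreal (\<Sum>z\<in>A. 4 * V * (p z * ln N + 1 / N))" by (intro ennreal_leI sum_mono on_A)
    also have "(\<Sum>z\<in>A. 4 * V * (p z * ln N + 1 / N)) = 4 * V * (ln N * (\<Sum>z\<in>A. p z) + card A / N)"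
      by (simp add: sum.distrib sum_distrib_left algebra_simps)
    also have "\<dots> \<le> 4 * V * (ln N * 1 + 1)"
    proof -
      have "ennreal (\<Sum>z\<in>A. p z) = (\<integral>\<^sup>+z. ennreal (p z) * indicator A z \<partial>count_space UNIV)"
        using A(1) p0 by (subst nn_integral_count_space'[of A]) (auto simp: sum_ennreal intro!: sum.cong)
      also have "\<dots> \<le> 1" unfolding sum_p[symmetric] by (intro nn_integral_mono) (auto simp: indicator_def)
      finally have "(\<Sum>z\<in>A. p z) \<le> 1" by simp
      then show ?thesis using A V by (intro mult_left_mono add_mono) auto
    qed
    finally show ?thesis by (simp add: ennreal_leI)
  qed
  also have "(\<integral>\<^sup>+z. ennreal (\<Sum>k\<in>K. ?h k z) * indicator (- A) z \<partial>count_space UNIV)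
      \<le> ennreal (real (card K) * (l * P + F / (4 * l)))"
  proof -
    have "(\<integral>\<^sup>+z. ennreal (\<Sum>k\<in>K. ?h k z) * indicator (- A) z \<partial>count_space UNIV)
       = (\<Sum>k\<in>K. \<integral>\<^sup>+z. ennreal (?h k z) * indicator (- A) z \<partial>count_space UNIV)"
    proof -
      have "ennreal (\<Sum>k\<in>K. ?h k z) * indicator (- A) z = (\<Sum>k\<in>K. ennreal (?h k z) * indicator (- A) z)" for z
        by (simp add: sum_distrib_right[symmetric])
      then show ?thesis by (simp add: nn_integral_sum)
    qed
    also have "\<dots> \<le> (\<Sum>k\<in>K. ennreal (l * P + F / (4 * l)))"
    proof (rule sum_mono)
      fix k assume k: "k \<in> K"
      have "(\<integral>\<^sup>+z. ennreal (?h k z) * indicator (- A) z \<partial>count_space UNIV)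
        \<le> (\<integral>\<^sup>+z. ennreal l * (ennreal (p z) * indicator (- A) z)
           + ennreal (1 / (4 * l)) * (\<integral>\<^sup>+x. ennreal (pmf (\<kappa> x) z * W k x ^ 4) \<partial>M) \<partial>count_space UNIV)"
      proof (rule nn_integral_mono)
        fix z
        have "ennreal (?h k z) \<le> ennreal (l * p z + 1 / (4 * l) * expectation (\<lambda>x. pmf (\<kappa> x) z * W k x ^ 4))"
          using off_A[OF k, of z] by (intro ennreal_leI) simp
        also have "\<dots> = ennreal l * ennreal (p z) + ennreal (1 / (4 * l)) * ennreal (expectation (\<lambda>x. pmf (\<kappa> x) z * W k x ^ 4))"
          using l p0[of z] by (subst ennreal_plus) (auto simp del: times_divide_eq_left simp: ennreal_mult)
        also have "ennreal (expectation (\<lambda>x. pmf (\<kappa> x) z * W k x ^ 4)) = (\<integral>\<^sup>+x. ennreal (pmf (\<kappa> x) z * W k x ^ 4) \<partial>M)"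
          using i\<kappa>W4[OF k] by (subst nn_integral_eq_integral) auto
        finally show "ennreal (?h k z) * indicator (- A) z \<le> ennreal l * (ennreal (p z) * indicator (- A) z)
           + ennreal (1 / (4 * l)) * (\<integral>\<^sup>+x. ennreal (pmf (\<kappa> x) z * W k x ^ 4) \<partial>M)"
          by (auto simp: indicator_def)
      qed
      also have "\<dots> = ennreal l * (\<integral>\<^sup>+z. ennreal (p z) * indicator (- A) z \<partial>count_space UNIV)
         + ennreal (1 / (4 * l)) * (\<integral>\<^sup>+z. \<integral>\<^sup>+x. ennreal (pmf (\<kappa> x) z * W k x ^ 4) \<partial>M \<partial>count_space UNIV)"
        by (subst nn_integral_add) (auto simp: nn_integral_cmult)
      also have "(\<integral>\<^sup>+z. \<integral>\<^sup>+x. ennreal (pmf (\<kappa> x) z * W k x ^ 4) \<partial>M \<partial>count_space UNIV)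
         = (\<integral>\<^sup>+x. \<integral>\<^sup>+z. ennreal (pmf (\<kappa> x) z * W k x ^ 4) \<partial>count_space UNIV \<partial>M)"
        using W(1)[OF k] \<kappa> by (intro nn_integral_count_space_nn_integral[symmetric]) auto
      also have "\<dots> = (\<integral>\<^sup>+x. ennreal (W k x ^ 4) \<partial>M)"
        by (intro nn_integral_cong) (simp add: ennreal_mult nn_integral_multc nn_integral_pmf)
      also have "ennreal l * (\<integral>\<^sup>+z. ennreal (p z) * indicator (- A) z \<partial>count_space UNIV)
         + ennreal (1 / (4 * l)) * (\<integral>\<^sup>+x. ennreal (W k x ^ 4) \<partial>M) \<le> ennreal l * ennreal P + ennreal (1 / (4 * l)) * ennreal F"
        by (intro add_mono mult_left_mono P F k) auto
      also have "\<dots> = ennreal (l * P + F / (4 * l))"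
        using l P(1) F(1) by (simp add: ennreal_mult[symmetric] ennreal_plus[symmetric] del: ennreal_plus)
      finally show "(\<integral>\<^sup>+z. ennreal (?h k z) * indicator (- A) z \<partial>count_space UNIV) \<le> ennreal (l * P + F / (4 * l))" .
    qed
    also have "\<dots> = ennreal (real (card K) * (l * P + F / (4 * l)))"
      using l P(1) F(1) by (simp add: ennreal_mult ennreal_of_nat_eq_real_of_nat)
    finally show ?thesis .
  qed
  also have "ennreal (4 * V * (ln N + 1)) + ennreal (real (card K) * (l * P + F / (4 * l)))
    = ennreal (4 * V * (ln N + 1) + real (card K) * (l * P + F / (4 * l)))"
    using V A(3) l P(1) F(1) by (intro ennreal_plus[symmetric]) auto
  finally show ?thesis by (simp add: add_mono)
qed

section \<open>Two hypotheses seen through independent transcripts\<close>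

lemma PiM_countable_density:
  fixes p :: "'i \<Rightarrow> 'z::countable \<Rightarrow> ennreal"
  assumes I: "finite I" and p: "\<And>i. i \<in> I \<Longrightarrow> integral\<^sup>N (count_space UNIV) (p i) = 1"
  shows "PiM I (\<lambda>i. density (count_space UNIV) (p i)) =
    density (count_space (PiE I (\<lambda>_. UNIV))) (\<lambda>z. \<Prod>i\<in>I. p i (z i))" (is "?P = ?D")
proof (rule measure_eqI_countable)
  have sets_P: "sets ?P = sets (count_space (PiE I (\<lambda>_. UNIV)) :: ('i \<Rightarrow> 'z) measure)"
    using count_space_PiM_finite[OF I, of "\<lambda>_. UNIV :: 'z set"] 
    by (metis countableI_type sets_PiM_cong sets_density)
  then show "sets ?P = Pow (PiE I (\<lambda>_. UNIV))" by simp
  show "countable (PiE I (\<lambda>_. UNIV :: 'z set))" by (intro countable_PiE I) auto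
  fix z assume z: "z \<in> PiE I (\<lambda>_. UNIV :: 'z set)"
  have prob: "prob_space (density (count_space UNIV) (p i))" if "i \<in> I" for i
    using p[OF that] by (intro prob_spaceI) (simp add: emeasure_density)
  have "{z} = PiE I (\<lambda>i. {z i})" using z PiE_singleton[of z I] by (simp add: PiE_iff)
  also have "\<dots> = prod_emb I (\<lambda>i. density (count_space UNIV) (p i)) I (PiE I (\<lambda>i. {z i}))"
    by (subst prod_emb_PiE_same_index) auto
  finally have "emeasure ?P {z} = (\<Prod>i\<in>I. emeasure (density (count_space UNIV) (p i)) {z i})"
    using I by (simp only:, subst emeasure_PiM_emb) (auto simp: prob)
  also have "\<dots> = (\<Prod>i\<in>I. p i (z i))"
    by (intro prod.cong) (auto simp: emeasure_density nn_integral_count_space_indicator[symmetric])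
  also have "\<dots> = emeasure ?D {z}"
    using z by (auto simp: emeasure_density)
  finally show "emeasure ?P {z} = emeasure ?D {z}" .
qed simp

lemma sqrt_prod: "sqrt (\<Prod>i\<in>A. f i) = (\<Prod>i\<in>A. sqrt (f i))"
  by (induction A rule: infinite_finite_induct) (auto simp: real_sqrt_mult)

text \<open>With \<open>u\<^sup>2\<close> and \<open>v\<^sup>2\<close> the likelihoods of the means \<open>a\<close> and \<open>- a\<close>, no single value \<open>x\<close> is close to both
  means, and the price is linear in the affinity \<open>u * v\<close>. The added multiple of \<open>u\<^sup>2 + v\<^sup>2\<close> integrates to a
  constant and avoids quotients of likelihoods.\<close>
lemma two_point_quadratic:
  fixes x a u v :: real
  shows "4 * a\<^sup>2 * (u * v) \<le> (x - a)\<^sup>2 * u\<^sup>2 + (x + a)\<^sup>2 * v\<^sup>2 + a\<^sup>2 * (u\<^sup>2 + v\<^sup>2)"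
proof -
  define s where "s = u\<^sup>2 + v\<^sup>2"
  let ?e = "(x - a)\<^sup>2 * u\<^sup>2 + (x + a)\<^sup>2 * v\<^sup>2 + a\<^sup>2 * s - 4 * a\<^sup>2 * (u * v)"
  show ?thesis
  proof (cases "s = 0")
    case True
    then show ?thesis by (simp add: s_def)
  next
    case False
    then have s: "0 < s" using sum_power2_ge_zero[of u v] by (simp add: s_def less_le)
    \<comment> \<open>Completing the square in \<open>x\<close>.\<close>
    have "s * ?e = (x * s - a * (u\<^sup>2 - v\<^sup>2))\<^sup>2 + a\<^sup>2 * ((u - v)\<^sup>2)\<^sup>2"
      unfolding s_def by algebra
    then have "0 \<le> s * ?e" by simp
    then have "0 \<le> ?e" using s by (simp add: zero_le_mult_iff)
    then show ?thesis by (simp add: s_def)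
  qed
qed

text \<open>A quantitative form of Le Cam's method. The affinity of product laws is the
  product of the affinities \<open>1 - h i / 2\<close>, so a risk well below \<open>a\<^sup>2\<close> is possible only if the squared Hellinger distances
  \<open>h i\<close> of the machines add up to a constant.\<close>
lemma two_point_risk_bound:
  fixes p p' :: "'i \<Rightarrow> 'z::countable \<Rightarrow> real" and f :: "('i \<Rightarrow> 'z) \<Rightarrow> real"
  assumes I: "finite I"
    and p: "\<And>i z. i \<in> I \<Longrightarrow> 0 \<le> p i z" "\<And>i. i \<in> I \<Longrightarrow> (\<integral>\<^sup>+z. ennreal (p i z) \<partial>count_space UNIV) = 1"
    and p': "\<And>i z. i \<in> I \<Longrightarrow> 0 \<le> p' i z" "\<And>i. i \<in> I \<Longrightarrow> (\<integral>\<^sup>+z. ennreal (p' i z) \<partial>count_space UNIV) = 1"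
    and h: "\<And>i. i \<in> I \<Longrightarrow> 0 \<le> h i"
      "\<And>i. i \<in> I \<Longrightarrow> (\<integral>\<^sup>+z. ennreal ((sqrt (p i z) - sqrt (p' i z))\<^sup>2) \<partial>count_space UNIV) = ennreal (h i)"
  shows "ennreal (4 * a\<^sup>2 * (1 - (\<Sum>i\<in>I. h i) / 2))
    \<le> (\<integral>\<^sup>+z. ennreal ((f z - a)\<^sup>2) \<partial>PiM I (\<lambda>i. density (count_space UNIV) (\<lambda>z. ennreal (p i z))))
     + (\<integral>\<^sup>+z. ennreal ((f z + a)\<^sup>2) \<partial>PiM I (\<lambda>i. density (count_space UNIV) (\<lambda>z. ennreal (p' i z))))
     + ennreal (2 * a\<^sup>2)"
proof -
  let ?C = "count_space (PiE I (\<lambda>_. UNIV :: 'z set))"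
  let ?P = "PiM I (\<lambda>i. density (count_space UNIV) (\<lambda>z. ennreal (p i z)))"
  let ?P' = "PiM I (\<lambda>i. density (count_space UNIV) (\<lambda>z. ennreal (p' i z)))"
  let ?g = "\<lambda>z. \<Prod>i\<in>I. p i (z i)" and ?g' = "\<lambda>z. \<Prod>i\<in>I. p' i (z i)"
  let ?r = "\<lambda>i z. sqrt (p i z) * sqrt (p' i z)"
  have g: "0 \<le> ?g z" "0 \<le> ?g' z" for z by (auto intro!: prod_nonneg simp: p p')
  have P: "?P = density ?C (\<lambda>z. ennreal (?g z))" "?P' = density ?C (\<lambda>z. ennreal (?g' z))"
    using p p' by (subst PiM_countable_density[OF I]; simp add: prod_ennreal)+
  have prob: "prob_space ?P" "prob_space ?P'"
    by (rule prob_space_PiM; rule prob_spaceI; simp add: emeasure_density p p')+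
  have one: "(\<integral>\<^sup>+z. ennreal (?g z) \<partial>?C) = 1" "(\<integral>\<^sup>+z. ennreal (?g' z) \<partial>?C) = 1"
  proof -
    have "(\<integral>\<^sup>+z. 1 \<partial>?P) = 1" "(\<integral>\<^sup>+z. 1 \<partial>?P') = 1"
      using prob[THEN prob_space.emeasure_space_1] by simp_all
    then show "(\<integral>\<^sup>+z. ennreal (?g z) \<partial>?C) = 1" "(\<integral>\<^sup>+z. ennreal (?g' z) \<partial>?C) = 1"
      unfolding P by (simp_all add: nn_integral_density del: nn_integral_const)
  qed
  interpret product_sigma_finite "\<lambda>_::'i. count_space (UNIV :: 'z set)"
    by (simp add: product_sigma_finite_def sigma_finite_measure_count_space)
  have aff1: "(\<integral>\<^sup>+z. ennreal (?r i z) \<partial>count_space UNIV) = ennreal (1 - h i / 2)" "h i / 2 \<in> {0..1}"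
    if i: "i \<in> I" for i
  proof -
    have "(\<integral>\<^sup>+z. 2 * ennreal (?r i z) + ennreal ((sqrt (p i z) - sqrt (p' i z))\<^sup>2) \<partial>count_space UNIV)
      = (\<integral>\<^sup>+z. ennreal (p i z) + ennreal (p' i z) \<partial>count_space UNIV)"
    proof (rule nn_integral_cong)
      fix z
      have "2 * ?r i z + (sqrt (p i z) - sqrt (p' i z))\<^sup>2 = p i z + p' i z"
        using p(1)[OF i, of z] p'(1)[OF i, of z] by (simp add: power2_eq_square algebra_simps)
      then have "ennreal (2 * ?r i z + (sqrt (p i z) - sqrt (p' i z))\<^sup>2) = ennreal (p i z + p' i z)" by simp
      then show "2 * ennreal (?r i z) + ennreal ((sqrt (p i z) - sqrt (p' i z))\<^sup>2) = ennreal (p i z) + ennreal (p' i z)"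
        using p(1)[OF i, of z] p'(1)[OF i, of z] by (simp add: ennreal_mult)
    qed
    then have eq: "2 * (\<integral>\<^sup>+z. ennreal (?r i z) \<partial>count_space UNIV) + ennreal (h i) = 2"
      by (simp add: nn_integral_add nn_integral_cmult h[OF i] p(2)[OF i] p'(2)[OF i])
    define b where "b = (\<integral>\<^sup>+z. ennreal (?r i z) \<partial>count_space UNIV)"
    have "b < top" using eq unfolding b_def[symmetric]
      by (metis ennreal_add_eq_top ennreal_mult_eq_top_iff ennreal_numeral ennreal_neq_top less_top zero_neq_numeral)
    then obtain b' where b': "b = ennreal b'" "0 \<le> b'" by (cases b) auto
    have "ennreal (2 * b' + h i) = ennreal 2"
      using eq b' h(1)[OF i] unfolding b_def[symmetric] by (simp add: ennreal_mult)
    then have "2 * b' + h i = 2" using b' h(1)[OF i] by (subst (asm) ennreal_inj) auto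
    then have "b' = 1 - h i / 2" "h i \<le> 2" using b' by auto
    then show "(\<integral>\<^sup>+z. ennreal (?r i z) \<partial>count_space UNIV) = ennreal (1 - h i / 2)" "h i / 2 \<in> {0..1}"
      using b' h(1)[OF i] by (auto simp: b_def[symmetric])
  qed
  have "ennreal (4 * a\<^sup>2 * (1 - (\<Sum>i\<in>I. h i) / 2)) \<le> ennreal (4 * a\<^sup>2 * (\<Prod>i\<in>I. 1 - h i / 2))"
    using Weierstrass_prod_ineq[of I "\<lambda>i. h i / 2"] aff1(2)
    by (intro ennreal_leI mult_left_mono) (auto simp: sum_divide_distrib)
  also have "\<dots> = ennreal (4 * a\<^sup>2) * (\<Prod>i\<in>I. \<integral>\<^sup>+z. ennreal (?r i z) \<partial>count_space UNIV)"
    using aff1 by (subst ennreal_mult) (auto intro!: prod_nonneg simp: prod_ennreal)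
  also have "(\<Prod>i\<in>I. \<integral>\<^sup>+z. ennreal (?r i z) \<partial>count_space UNIV) = (\<integral>\<^sup>+z. (\<Prod>i\<in>I. ennreal (?r i (z i))) \<partial>?C)"
    by (subst count_space_PiM_finite[OF I, symmetric]) (auto intro!: product_nn_integral_prod[symmetric] I)
  also have "ennreal (4 * a\<^sup>2) * \<dots> = (\<integral>\<^sup>+z. ennreal (4 * a\<^sup>2) * (\<Prod>i\<in>I. ennreal (?r i (z i))) \<partial>?C)"
    by (subst nn_integral_cmult) auto
  also have "\<dots> \<le> (\<integral>\<^sup>+z. (ennreal (?g z) * ennreal ((f z - a)\<^sup>2) + ennreal (?g' z) * ennreal ((f z + a)\<^sup>2))
     + ennreal (a\<^sup>2) * (ennreal (?g z) + ennreal (?g' z)) \<partial>?C)"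
  proof (rule nn_integral_mono)
    fix z
    let ?u = "sqrt (?g z)" and ?v = "sqrt (?g' z)"
    have r: "(\<Prod>i\<in>I. ennreal (?r i (z i))) = ennreal (?u * ?v)"
      using p p' by (subst prod_ennreal) (auto simp: prod.distrib sqrt_prod)
    have "4 * a\<^sup>2 * (?u * ?v) \<le> (f z - a)\<^sup>2 * ?g z + (f z + a)\<^sup>2 * ?g' z + a\<^sup>2 * (?g z + ?g' z)"
      using two_point_quadratic[of a ?u ?v "f z"] g[of z] by simp
    then have "ennreal (4 * a\<^sup>2 * (?u * ?v)) \<le> ennreal ((f z - a)\<^sup>2 * ?g z + (f z + a)\<^sup>2 * ?g' z + a\<^sup>2 * (?g z + ?g' z))"
      by (rule ennreal_leI)
    then show "ennreal (4 * a\<^sup>2) * (\<Prod>i\<in>I. ennreal (?r i (z i))) \<le> (ennreal (?g z) * ennreal ((f z - a)\<^sup>2) + ennreal (?g' z) * ennreal ((f z + a)\<^sup>2))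
     + ennreal (a\<^sup>2) * (ennreal (?g z) + ennreal (?g' z))"
      unfolding r using g[of z] by (simp add: ennreal_mult mult_ac)
  qed
  also have "\<dots> = (\<integral>\<^sup>+z. ennreal (?g z) * ennreal ((f z - a)\<^sup>2) \<partial>?C) + (\<integral>\<^sup>+z. ennreal (?g' z) * ennreal ((f z + a)\<^sup>2) \<partial>?C)
     + ennreal (a\<^sup>2) * (1 + 1)"
    by (simp add: nn_integral_add nn_integral_cmult one)
  also have "ennreal (a\<^sup>2) * (1 + 1) = ennreal (2 * a\<^sup>2)"
    by (simp add: ennreal_mult mult.commute)
  finally show ?thesis unfolding P by (simp add: nn_integral_density)
qed

section \<open>Reflecting the mean of a Gaussian\<close>

lemma exp_le_quadratic:
  fixes y :: real assumes "y \<le> 1" shows "exp y \<le> 1 + y + y\<^sup>2"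
proof (cases "0 \<le> y")
  case True then show ?thesis using exp_bound assms by simp
next
  case False
  define t where "t = - y"
  have t: "0 < t" using False by (simp add: t_def)
  have "1 + t + t\<^sup>2 / 2 \<le> exp t" using exp_lower_Taylor_quadratic[of t] t by simp
  moreover have "1 \<le> (1 - t + t\<^sup>2) * (1 + t + t\<^sup>2 / 2)"
  proof -
    have "(1 - t + t\<^sup>2) * (1 + t + t\<^sup>2 / 2) = 1 + (t^2 + t^3 + t^4) / 2"
      by (simp add: field_simps power2_eq_square power3_eq_cube power4_eq_xxxx)
    then show ?thesis using t by simp
  qed
  moreover have "0 < 1 - t + t\<^sup>2"
  proof -
    have "1 - t + t\<^sup>2 = (t - 1 / 2)\<^sup>2 + 3 / 4"
      by (simp add: power2_eq_square field_simps)
    then show ?thesis using zero_le_power2[of "t - 1 / 2"] by linarith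
  qed
  ultimately have "1 \<le> (1 - t + t\<^sup>2) * exp t"
    by (meson mult_left_mono less_imp_le order_trans)
  then have "exp (- t) \<le> 1 - t + t\<^sup>2"
    by (simp add: exp_minus field_simps)
  then show ?thesis by (simp add: t_def)
qed

lemma nn_integral_normal_exp:
  assumes \<sigma>: "0 < \<sigma>"
  shows "(\<integral>\<^sup>+x. ennreal (exp (s * x)) \<partial>density lborel (normal_density \<mu> \<sigma>)) = ennreal (exp (\<mu> * s + \<sigma>\<^sup>2 * s\<^sup>2 / 2))"
proof -
  interpret N: prob_space "density lborel (normal_density (\<mu> + \<sigma>\<^sup>2 * s) \<sigma>)"
    by (rule prob_space_normal_density[OF \<sigma>])
  have tilt: "normal_density \<mu> \<sigma> x * exp (s * x)
      = exp (\<mu> * s + \<sigma>\<^sup>2 * s\<^sup>2 / 2) * normal_density (\<mu> + \<sigma>\<^sup>2 * s) \<sigma> x" for x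
  proof -
    have "- (x - \<mu>)\<^sup>2 / (2 * \<sigma>\<^sup>2) + s * x
        = (\<mu> * s + \<sigma>\<^sup>2 * s\<^sup>2 / 2) + - (x - (\<mu> + \<sigma>\<^sup>2 * s))\<^sup>2 / (2 * \<sigma>\<^sup>2)"
      using \<sigma> by (simp add: field_simps power2_eq_square)
    then have "exp (- (x - \<mu>)\<^sup>2 / (2 * \<sigma>\<^sup>2)) * exp (s * x)
        = exp (\<mu> * s + \<sigma>\<^sup>2 * s\<^sup>2 / 2) * exp (- (x - (\<mu> + \<sigma>\<^sup>2 * s))\<^sup>2 / (2 * \<sigma>\<^sup>2))"
      unfolding exp_add[symmetric] by simp
    then show ?thesis by (simp add: normal_density_def)
  qed
  have "(\<integral>\<^sup>+x. ennreal (exp (s * x)) \<partial>density lborel (normal_density \<mu> \<sigma>))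
      = (\<integral>\<^sup>+x. ennreal (normal_density \<mu> \<sigma> x * exp (s * x)) \<partial>lborel)"
    by (subst nn_integral_density) (auto simp: ennreal_mult)
  also have "\<dots> = (\<integral>\<^sup>+x. ennreal (exp (\<mu> * s + \<sigma>\<^sup>2 * s\<^sup>2 / 2)) * ennreal (normal_density (\<mu> + \<sigma>\<^sup>2 * s) \<sigma> x) \<partial>lborel)"
    unfolding tilt by (simp add: ennreal_mult)
  also have "\<dots> = ennreal (exp (\<mu> * s + \<sigma>\<^sup>2 * s\<^sup>2 / 2)) * (\<integral>\<^sup>+x. ennreal (normal_density (\<mu> + \<sigma>\<^sup>2 * s) \<sigma> x) \<partial>lborel)"
    by (rule nn_integral_cmult) auto
  also have "(\<integral>\<^sup>+x. ennreal (normal_density (\<mu> + \<sigma>\<^sup>2 * s) \<sigma> x) \<partial>lborel) = 1"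
    using N.emeasure_space_1 by (simp add: emeasure_density)
  finally show ?thesis by simp
qed

lemma normal_density_reflect:
  "0 < \<sigma> \<Longrightarrow> normal_density (- \<mu>) \<sigma> y = normal_density \<mu> \<sigma> y * exp (- 2 * \<mu> / \<sigma>\<^sup>2 * y)"
proof -
  assume \<sigma>: "0 < \<sigma>"
  have "- (y + \<mu>)\<^sup>2 / (2 * \<sigma>\<^sup>2) = - (y - \<mu>)\<^sup>2 / (2 * \<sigma>\<^sup>2) + (- 2 * \<mu> / \<sigma>\<^sup>2 * y)"
    using \<sigma> by (simp add: field_simps power2_eq_square)
  then have "exp (- (y + \<mu>)\<^sup>2 / (2 * \<sigma>\<^sup>2)) = exp (- (y - \<mu>)\<^sup>2 / (2 * \<sigma>\<^sup>2)) * exp (- 2 * \<mu> / \<sigma>\<^sup>2 * y)"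
    unfolding exp_add[symmetric] by simp
  then show ?thesis by (simp add: normal_density_def)
qed

lemma normal_exp_moment:
  fixes \<sigma> \<mu> s :: real
  assumes \<sigma>: "0 < \<sigma>"
  defines "N \<equiv> density lborel (normal_density \<mu> \<sigma>)"
  shows "integrable N (\<lambda>x. exp (s * x))" "integral\<^sup>L N (\<lambda>x. exp (s * x)) = exp (\<mu> * s + \<sigma>\<^sup>2 * s\<^sup>2 / 2)"
proof -
  have m: "(\<lambda>x. exp (s * x)) \<in> borel_measurable N" by (simp add: N_def)
  have eq: "(\<integral>\<^sup>+x. ennreal (exp (s * x)) \<partial>N) = ennreal (exp (\<mu> * s + \<sigma>\<^sup>2 * s\<^sup>2 / 2))"
    unfolding N_def by (rule nn_integral_normal_exp[OF \<sigma>])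
  show "integrable N (\<lambda>x. exp (s * x))" using m eq by (intro integrableI_nonneg) auto
  show "integral\<^sup>L N (\<lambda>x. exp (s * x)) = exp (\<mu> * s + \<sigma>\<^sup>2 * s\<^sup>2 / 2)"
    using m eq by (subst integral_eq_nn_integral) auto
qed

text \<open>Below, \<open>r\<close> is the likelihood ratio of the mean \<open>- \<mu>\<close> against \<open>\<mu>\<close>; it is log-normal, and
  \<open>t\<close> is the squared distance of the two means in units of \<open>\<sigma>\<close>. The constant \<open>K\<close> absorbs the
  deviation of \<open>exp t - 1\<close> from \<open>t\<close>, so that \<open>t\<close> may be any bounded quantity.\<close>
context
  fixes \<sigma> \<mu> t K :: real and N :: "real measure" and r :: "real \<Rightarrow> real"
  assumes \<sigma>: "0 < \<sigma>" and t: "t = 4 * \<mu>\<^sup>2 / \<sigma>\<^sup>2" and K: "exp t \<le> K"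
  defines "N \<equiv> density lborel (normal_density \<mu> \<sigma>)"
    and "r \<equiv> \<lambda>y. exp (- 2 * \<mu> / \<sigma>\<^sup>2 * y)"
begin

lemma reflect_ratio_moment:
  "integrable N (\<lambda>y. r y ^ n)" "integral\<^sup>L N (\<lambda>y. r y ^ n) = exp (t * (real n * (real n - 1) / 2))"
proof -
  have eq: "r y ^ n = exp ((real n * (- 2 * \<mu> / \<sigma>\<^sup>2)) * y)" for y
    unfolding r_def by (subst exp_of_nat_mult[symmetric]) (simp add: mult_ac)
  show "integrable N (\<lambda>y. r y ^ n)" unfolding eq N_def by (rule normal_exp_moment[OF \<sigma>])
  have "\<mu> * (real n * (- 2 * \<mu> / \<sigma>\<^sup>2)) + \<sigma>\<^sup>2 * (real n * (- 2 * \<mu> / \<sigma>\<^sup>2))\<^sup>2 / 2 = t * (real n * (real n - 1) / 2)"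
    using \<sigma> by (simp add: t field_simps power2_eq_square)
  then show "integral\<^sup>L N (\<lambda>y. r y ^ n) = exp (t * (real n * (real n - 1) / 2))"
    unfolding eq N_def normal_exp_moment(2)[OF \<sigma>] by simp
qed

lemma reflect_exponent_nonneg: "0 \<le> t" by (simp add: t)

lemma reflect_exp_exponent_le: "exp t - 1 \<le> K * t"
proof -
  have "1 - t \<le> exp (- t)" using exp_ge_add_one_self[of "- t"] by simp
  then have "exp t * (1 - t) \<le> exp t * exp (- t)" by (intro mult_left_mono) auto
  then have "exp t - 1 \<le> exp t * t" by (simp add: exp_minus algebra_simps)
  also have "\<dots> \<le> K * t" using K reflect_exponent_nonneg by (intro mult_right_mono)
  finally show ?thesis .
qed

lemma prob_space_reflect: "prob_space N"
  unfolding N_def by (rule prob_space_normal_density[OF \<sigma>])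

lemma reflect_ratio_fourth_moment:
  "(\<integral>\<^sup>+y. ennreal ((1 - r y) ^ 4) \<partial>N) \<le> ennreal (6 * K ^ 6 * t\<^sup>2)"
proof -
  interpret prob_space N by (rule prob_space_reflect)
  define u where "u = exp t"
  have u: "1 \<le> u" "u \<le> K" "u - 1 \<le> K * t" using reflect_exponent_nonneg K reflect_exp_exponent_le by (auto simp: u_def)
  have expand: "(1 - r y) ^ 4 = 1 - 4 * r y ^ 1 + 6 * r y ^ 2 - 4 * r y ^ 3 + r y ^ 4" for y by algebra
  have i: "integrable N (\<lambda>y. (1 - r y) ^ 4)" unfolding expand
    by (intro Bochner_Integration.integrable_add Bochner_Integration.integrable_diff integrable_mult_right reflect_ratio_moment) auto
  have "integral\<^sup>L N (\<lambda>y. (1 - r y) ^ 4) = 1 - 4 * exp (t * 0) + 6 * exp (t * 1) - 4 * exp (t * 3) + exp (t * 6)"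
    unfolding expand
    using reflect_ratio_moment[of 1] reflect_ratio_moment[of 2] reflect_ratio_moment[of 3] reflect_ratio_moment[of 4]
    by (simp add: prob_space)
  also have "\<dots> = 1 - 4 + 6 * u - 4 * u ^ 3 + u ^ 6"
    by (simp add: u_def exp_of_nat_mult[symmetric] mult.commute)
  also have "\<dots> = (u - 1)\<^sup>2 * (u ^ 4 + 2 * u ^ 3 + 3 * u\<^sup>2 - 3)" by algebra
  also have "\<dots> \<le> (K * t)\<^sup>2 * (6 * K ^ 4)"
  proof (rule mult_mono)
    have "u ^ 3 \<le> u ^ 4" "u\<^sup>2 \<le> u ^ 4" using u by (auto intro!: power_increasing)
    moreover have "u ^ 4 \<le> K ^ 4" using u by (intro power_mono) auto
    ultimately show "u ^ 4 + 2 * u ^ 3 + 3 * u\<^sup>2 - 3 \<le> 6 * K ^ 4" by linarith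
    have "1 \<le> u ^ 2" using u by simp
    then show "0 \<le> u ^ 4 + 2 * u ^ 3 + 3 * u\<^sup>2 - 3" using u by (smt (verit) zero_le_power)
    show "(u - 1)\<^sup>2 \<le> (K * t)\<^sup>2" using u by (intro power_mono) auto
  qed auto
  also have "\<dots> = 6 * K ^ 6 * t\<^sup>2" by algebra
  finally show ?thesis using i by (subst nn_integral_eq_integral) (auto intro!: ennreal_leI)
qed

text \<open>The score \<open>1 - r\<close> is at most \<open>1\<close>, which allows a second-order expansion when \<open>c \<le> 1\<close>; for larger \<open>c\<close>
  the linear bound \<open>1 - r \<le> - ln r\<close> has a Gaussian exponential moment.\<close>
lemma reflect_ratio_subgaussian:
  assumes c: "0 \<le> c"
  shows "(\<integral>\<^sup>+y. ennreal (exp (c * (1 - r y))) \<partial>N) \<le> ennreal (exp (K * t * c\<^sup>2))"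
proof (cases "c \<le> 1")
  case True
  interpret prob_space N by (rule prob_space_reflect)
  have expand: "1 + c * (1 - r y) + (c * (1 - r y))\<^sup>2 = 1 + c + c\<^sup>2 - (c + 2 * c\<^sup>2) * r y ^ 1 + c\<^sup>2 * r y ^ 2" for y
    by (simp add: power2_eq_square algebra_simps)
  have i: "integrable N (\<lambda>y. 1 + c * (1 - r y) + (c * (1 - r y))\<^sup>2)" unfolding expand
    by (intro Bochner_Integration.integrable_add Bochner_Integration.integrable_diff integrable_mult_right reflect_ratio_moment) auto
  have pos: "0 \<le> 1 + y + y\<^sup>2" for y :: real 
  proof -
    have "1 + y + y\<^sup>2 = (y + 1 / 2)\<^sup>2 + 3 / 4" by (simp add: power2_eq_square field_simps)
    then show ?thesis by simp
  qed
  have "(\<integral>\<^sup>+y. ennreal (exp (c * (1 - r y))) \<partial>N) \<le> (\<integral>\<^sup>+y. ennreal (1 + c * (1 - r y) + (c * (1 - r y))\<^sup>2) \<partial>N)"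
  proof (intro nn_integral_mono ennreal_leI exp_le_quadratic)
    fix y
    have "c * (1 - r y) \<le> c * 1" using c by (intro mult_left_mono) (auto simp: r_def)
    then show "c * (1 - r y) \<le> 1" using True by simp
  qed
  also have "\<dots> = ennreal (integral\<^sup>L N (\<lambda>y. 1 + c * (1 - r y) + (c * (1 - r y))\<^sup>2))"
    using i pos by (intro nn_integral_eq_integral) auto
  also have "integral\<^sup>L N (\<lambda>y. 1 + c * (1 - r y) + (c * (1 - r y))\<^sup>2) = 1 + c + c\<^sup>2 - (c + 2 * c\<^sup>2) * exp (t * 0) + c\<^sup>2 * exp (t * 1)"
    unfolding expand using reflect_ratio_moment[of 1] reflect_ratio_moment[of 2] by (simp add: prob_space)
  also have "\<dots> = 1 + c\<^sup>2 * (exp t - 1)" by (simp add: algebra_simps)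
  also have "\<dots> \<le> 1 + c\<^sup>2 * (K * t)" using reflect_exp_exponent_le by (intro add_left_mono mult_left_mono) auto
  also have "\<dots> \<le> exp (K * t * c\<^sup>2)" using exp_ge_add_one_self[of "K * t * c\<^sup>2"] by (simp add: mult_ac)
  finally show ?thesis by (simp add: ennreal_leI)
next
  case False
  have "(\<integral>\<^sup>+y. ennreal (exp (c * (1 - r y))) \<partial>N) \<le> (\<integral>\<^sup>+y. ennreal (exp (c * (2 * \<mu> / \<sigma>\<^sup>2) * y)) \<partial>N)"
  proof (intro nn_integral_mono ennreal_leI)
    fix y
    have "1 + (- 2 * \<mu> / \<sigma>\<^sup>2 * y) \<le> r y" unfolding r_def by (rule exp_ge_add_one_self)
    then have "c * (1 - r y) \<le> c * (2 * \<mu> / \<sigma>\<^sup>2 * y)" using c by (intro mult_left_mono) auto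
    then show "exp (c * (1 - r y)) \<le> exp (c * (2 * \<mu> / \<sigma>\<^sup>2) * y)" by (simp add: mult_ac)
  qed
  also have "\<dots> = ennreal (exp (\<mu> * (c * (2 * \<mu> / \<sigma>\<^sup>2)) + \<sigma>\<^sup>2 * (c * (2 * \<mu> / \<sigma>\<^sup>2))\<^sup>2 / 2))"
    unfolding N_def by (rule nn_integral_normal_exp[OF \<sigma>])
  also have "\<mu> * (c * (2 * \<mu> / \<sigma>\<^sup>2)) + \<sigma>\<^sup>2 * (c * (2 * \<mu> / \<sigma>\<^sup>2))\<^sup>2 / 2 = t * ((c + c\<^sup>2) / 2)"
    using \<sigma> by (simp add: t field_simps power2_eq_square)
  also have "\<dots> \<le> t * c\<^sup>2"
  proof -
    have "c \<le> c\<^sup>2" using False self_le_power[of c 2] by simp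
    then show ?thesis using reflect_exponent_nonneg by (intro mult_left_mono) auto
  qed
  also have "\<dots> \<le> K * t * c\<^sup>2"
  proof -
    have "1 \<le> K" using K reflect_exponent_nonneg by (meson one_le_exp_iff order_trans)
    then have "1 * (t * c\<^sup>2) \<le> K * (t * c\<^sup>2)" using reflect_exponent_nonneg by (intro mult_right_mono) auto
    then show ?thesis by (simp add: mult_ac)
  qed
  finally show ?thesis by (simp add: ennreal_leI)
qed

end

section \<open>Observations at the corners of a cube of coefficients\<close>

text \<open>The set \<open>S\<close> marks the positive coordinates, so that the corners of the cube are indexed by a power set and
  averages over random signs become sums over it.\<close>
definition corner :: "real \<Rightarrow> nat \<Rightarrow> nat set \<Rightarrow> coeffs" where
  "corner a J S = (\<lambda>j k. if j = J \<and> k \<in> {1..2 ^ J} then (if k \<in> S then a else - a) else 0)"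

definition flip :: "nat \<Rightarrow> nat set \<Rightarrow> nat set" where
  "flip k S = (if k \<in> S then S - {k} else insert k S)"

lemma flip_flip [simp]: "flip k (flip k S) = S"
  by (auto simp: flip_def)

lemma sets_obs_law: "sets (obs_law \<sigma> \<theta>) = sets obs_space"
  unfolding obs_law_def obs_space_def by (rule sets_PiM_cong) auto

lemma space_obs_law: "space (obs_law \<sigma> \<theta>) = space obs_space"
  by (rule sets_eq_imp_space_eq[OF sets_obs_law])

lemma measurable_obs_law: "measurable (obs_law \<sigma> \<theta>) N = measurable obs_space N"
  by (rule measurable_cong_sets[OF sets_obs_law refl])

lemma product_prob_space_normal:
  "0 < \<sigma> \<Longrightarrow> product_prob_space (\<lambda>jk. density lborel (normal_density (\<theta> (fst jk) (snd jk)) \<sigma>))"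
  by (intro product_prob_spaceI prob_space_normal_density)

lemma prob_space_obs_law: "0 < \<sigma> \<Longrightarrow> prob_space (obs_law \<sigma> \<theta>)"
  unfolding obs_law_def by (intro prob_space_PiM prob_space_normal_density)

lemma measurable_coeff [measurable]: "jk \<in> coeff_index \<Longrightarrow> (\<lambda>x. x jk) \<in> borel_measurable obs_space"
  unfolding obs_space_def by (rule measurable_component_singleton)

lemma nn_integral_obs_law_prod:
  fixes f :: "nat \<Rightarrow> real \<Rightarrow> ennreal"
  assumes \<sigma>: "0 < \<sigma>" and F: "F \<subseteq> {1..2 ^ J}" and f: "\<And>k. k \<in> F \<Longrightarrow> f k \<in> borel_measurable borel"
  shows "(\<integral>\<^sup>+x. (\<Prod>k\<in>F. f k (x (J, k))) \<partial>obs_law \<sigma> \<theta>) =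
    (\<Prod>k\<in>F. integral\<^sup>N (density lborel (normal_density (\<theta> J k) \<sigma>)) (f k))"
proof -
  interpret product_prob_space "\<lambda>jk. density lborel (normal_density (\<theta> (fst jk) (snd jk)) \<sigma>)" coeff_index
    by (rule product_prob_space_normal[OF \<sigma>])
  have inj: "inj_on (Pair J) F" by (auto intro: inj_onI)
  have "(\<integral>\<^sup>+x. (\<Prod>jk\<in>Pair J ` F. f (snd jk) (x jk)) \<partial>obs_law \<sigma> \<theta>) =
    (\<Prod>jk\<in>Pair J ` F. integral\<^sup>N (density lborel (normal_density (\<theta> (fst jk) (snd jk)) \<sigma>)) (f (snd jk)))"
    unfolding obs_law_def
    by (rule nn_integral_PiM_prod_subset) (use F f in \<open>auto simp: coeff_index_def finite_subset\<close>)
  then show ?thesis by (simp add: prod.reindex[OF inj])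
qed

lemma obs_law_eq_density:
  assumes \<sigma>: "0 < \<sigma>" and F: "F \<subseteq> {1..2 ^ J}"
    and \<theta>: "\<And>j k. (j, k) \<notin> Pair J ` F \<Longrightarrow> \<theta>' j k = \<theta> j k"
    and r: "\<And>k. k \<in> F \<Longrightarrow> r k \<in> borel_measurable borel" "\<And>k y. k \<in> F \<Longrightarrow> 0 \<le> r k y"
      "\<And>k y. k \<in> F \<Longrightarrow> normal_density (\<theta>' J k) \<sigma> y = normal_density (\<theta> J k) \<sigma> y * r k y"
  shows "obs_law \<sigma> \<theta>' = density (obs_law \<sigma> \<theta>) (\<lambda>x. ennreal (\<Prod>k\<in>F. r k (x (J, k))))"
proof -
  interpret product_prob_space "\<lambda>jk. density lborel (normal_density (\<theta> (fst jk) (snd jk)) \<sigma>)" coeff_index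
    by (rule product_prob_space_normal[OF \<sigma>])
  have inj: "inj_on (Pair J) F" by (auto intro: inj_onI)
  have "obs_law \<sigma> \<theta>' = density (obs_law \<sigma> \<theta>) (\<lambda>x. \<Prod>jk\<in>Pair J ` F. ennreal (r (snd jk) (x jk)))"
    unfolding obs_law_def
  proof (rule PiM_density_finite)
    fix jk assume "jk \<in> Pair J ` F"
    then obtain k where k: "k \<in> F" "jk = (J, k)" by auto
    show "density lborel (\<lambda>x. ennreal (normal_density (\<theta>' (fst jk) (snd jk)) \<sigma> x)) =
      density (density lborel (\<lambda>x. ennreal (normal_density (\<theta> (fst jk) (snd jk)) \<sigma> x))) (\<lambda>y. ennreal (r (snd jk) y))"
      using k r(1)[OF k(1)] r(2,3)[OF k(1)] by (simp add: density_density_eq ennreal_mult)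
  next
    fix jk assume "jk \<in> coeff_index - Pair J ` F"
    then have "\<theta>' (fst jk) (snd jk) = \<theta> (fst jk) (snd jk)" by (intro \<theta>) auto
    then show "density lborel (\<lambda>x. ennreal (normal_density (\<theta>' (fst jk) (snd jk)) \<sigma> x)) =
      density lborel (\<lambda>x. ennreal (normal_density (\<theta> (fst jk) (snd jk)) \<sigma> x))" by simp
  qed (use F r \<sigma> in \<open>auto simp: coeff_index_def finite_subset prob_space_normal_density\<close>)
  then show ?thesis using r(2) by (simp add: prod.reindex[OF inj] prod_ennreal)
qed

section \<open>The transcript of one machine\<close>

definition transcript_prob ::
    "real \<Rightarrow> ((nat \<times> nat \<Rightarrow> real) \<Rightarrow> bool list pmf) \<Rightarrow> coeffs \<Rightarrow> bool list \<Rightarrow> real" where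
  "transcript_prob \<sigma> \<kappa> \<theta> z = (\<integral>x. pmf (\<kappa> x) z \<partial>obs_law \<sigma> \<theta>)"

text \<open>Unlike the expected length, the probability of a long transcript is bounded, and so it can be
  transferred between nearby laws.\<close>
definition long_prob ::
    "real \<Rightarrow> ((nat \<times> nat \<Rightarrow> real) \<Rightarrow> bool list pmf) \<Rightarrow> nat \<Rightarrow> coeffs \<Rightarrow> real" where
  "long_prob \<sigma> \<kappa> T \<theta> = (\<integral>x. measure (measure_pmf (\<kappa> x)) {z. T \<le> length z} \<partial>obs_law \<sigma> \<theta>)"

context
  fixes \<kappa> :: "(nat \<times> nat \<Rightarrow> real) \<Rightarrow> bool list pmf" and \<sigma> :: real
  assumes \<kappa>: "(\<lambda>x. measure_pmf (\<kappa> x)) \<in> obs_space \<rightarrow>\<^sub>M prob_algebra (count_space UNIV)"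
    and \<sigma>: "0 < \<sigma>"
begin

lemma measurable_encoder_measure: "(\<lambda>x. measure (measure_pmf (\<kappa> x)) B) \<in> borel_measurable (obs_law \<sigma> \<theta>)"
  unfolding measurable_obs_law by (rule measurable_compose[OF \<kappa>]) simp

lemma measurable_encoder: "(\<lambda>x. pmf (\<kappa> x) z) \<in> borel_measurable (obs_law \<sigma> \<theta>)"
  using measurable_encoder_measure[of "{z}" \<theta>] by (simp add: measure_pmf_single)

lemma integrable_encoder_measure: "integrable (obs_law \<sigma> \<theta>) (\<lambda>x. measure (measure_pmf (\<kappa> x)) B)"
proof -
  interpret prob_space "obs_law \<sigma> \<theta>" by (rule prob_space_obs_law[OF \<sigma>])
  show ?thesis by (intro integrable_const_bound[of _ 1] measurable_encoder_measure) auto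
qed

lemma emeasure_transcript:
  "emeasure (obs_law \<sigma> \<theta> \<bind> (\<lambda>x. measure_pmf (\<kappa> x))) B = ennreal (\<integral>x. measure (measure_pmf (\<kappa> x)) B \<partial>obs_law \<sigma> \<theta>)"
proof -
  interpret prob_space "obs_law \<sigma> \<theta>" by (rule prob_space_obs_law[OF \<sigma>])
  have "emeasure (obs_law \<sigma> \<theta> \<bind> (\<lambda>x. measure_pmf (\<kappa> x))) B = (\<integral>\<^sup>+x. emeasure (measure_pmf (\<kappa> x)) B \<partial>obs_law \<sigma> \<theta>)"
    using \<kappa> by (intro emeasure_bind_prob_algebra[where N=obs_space and L="count_space UNIV"])
      (auto simp: space_prob_algebra prob_space_axioms sets_obs_law)
  also have "\<dots> = ennreal (\<integral>x. measure (measure_pmf (\<kappa> x)) B \<partial>obs_law \<sigma> \<theta>)"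
    by (subst nn_integral_eq_integral[symmetric])
      (auto simp: integrable_encoder_measure measure_pmf.emeasure_eq_measure)
  finally show ?thesis .
qed

lemma sets_transcript: "sets (obs_law \<sigma> \<theta> \<bind> (\<lambda>x. measure_pmf (\<kappa> x))) = UNIV"
proof -
  interpret prob_space "obs_law \<sigma> \<theta>" by (rule prob_space_obs_law[OF \<sigma>])
  show ?thesis by (subst sets_bind[where N="count_space UNIV"]) (auto simp: not_empty)
qed

lemma transcript_eq_density:
  "obs_law \<sigma> \<theta> \<bind> (\<lambda>x. measure_pmf (\<kappa> x)) = density (count_space UNIV) (\<lambda>z. ennreal (transcript_prob \<sigma> \<kappa> \<theta> z))"
  by (rule measure_eqI_countable[where A=UNIV])
     (auto simp: sets_transcript emeasure_transcript emeasure_density transcript_prob_def measure_pmf_single)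

lemma transcript_prob_nonneg: "0 \<le> transcript_prob \<sigma> \<kappa> \<theta> z"
  unfolding transcript_prob_def by simp

lemma transcript_prob_sum: "(\<integral>\<^sup>+z. ennreal (transcript_prob \<sigma> \<kappa> \<theta> z) \<partial>count_space UNIV) = 1"
proof -
  interpret prob_space "obs_law \<sigma> \<theta>" by (rule prob_space_obs_law[OF \<sigma>])
  have "emeasure (obs_law \<sigma> \<theta> \<bind> (\<lambda>x. measure_pmf (\<kappa> x))) UNIV = 1"
    unfolding emeasure_transcript by (simp add: prob_space)
  then show ?thesis unfolding transcript_eq_density by (simp add: emeasure_density)
qed

lemma long_prob_eq:
  "(\<integral>\<^sup>+z. ennreal (transcript_prob \<sigma> \<kappa> \<theta> z) * indicator {z. T \<le> length z} z \<partial>count_space UNIV) = ennreal (long_prob \<sigma> \<kappa> T \<theta>)"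
proof -
  have "emeasure (obs_law \<sigma> \<theta> \<bind> (\<lambda>x. measure_pmf (\<kappa> x))) {z. T \<le> length z} = ennreal (long_prob \<sigma> \<kappa> T \<theta>)"
    unfolding emeasure_transcript long_prob_def ..
  then show ?thesis unfolding transcript_eq_density by (simp add: emeasure_density)
qed

lemma card_short_lists: "finite {z :: bool list. length z < T}" "card {z :: bool list. length z < T} \<le> 2 ^ T"
proof -
  have "finite {z :: bool list. length z < T} \<and> card {z :: bool list. length z < T} + 1 \<le> 2 ^ T"
  proof (induction T)
    case (Suc T)
    have eq: "{z :: bool list. length z < Suc T} = {z. length z < T} \<union> {z. set z \<subseteq> UNIV \<and> length z = T}" by auto
    have "card {z :: bool list. set z \<subseteq> UNIV \<and> length z = T} = 2 ^ T"
      by (subst card_lists_length_eq) auto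
    moreover have "finite {z :: bool list. set z \<subseteq> UNIV \<and> length z = T}" by (rule finite_lists_length_eq) auto
    ultimately show ?case unfolding eq using Suc
      card_Un_le[of "{z :: bool list. length z < T}" "{z. set z \<subseteq> UNIV \<and> length z = T}"] by simp
  qed simp
  then show "finite {z :: bool list. length z < T}" "card {z :: bool list. length z < T} \<le> 2 ^ T" by auto
qed

lemma corner_flip_density:
  assumes k: "k \<in> {1..2 ^ J}"
  shows "obs_law \<sigma> (corner a J (flip k S)) =
    density (obs_law \<sigma> (corner a J S)) (\<lambda>x. ennreal (exp (- 2 * corner a J S J k / \<sigma>\<^sup>2 * x (J, k))))"
proof -
  have neg: "corner a J (flip k S) J k = - corner a J S J k"
    using k by (auto simp: corner_def flip_def)
  have "obs_law \<sigma> (corner a J (flip k S)) = density (obs_law \<sigma> (corner a J S))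
     (\<lambda>x. ennreal (\<Prod>k\<in>{k}. exp (- 2 * corner a J S J k / \<sigma>\<^sup>2 * x (J, k))))"
    by (rule obs_law_eq_density[OF \<sigma>]) (use k in \<open>auto simp: neg normal_density_reflect[OF \<sigma>]\<close>,
      auto simp: corner_def flip_def)
  then show ?thesis by simp
qed

text \<open>The instance of \<open>message_information_bound\<close> for the signs of a corner: neighbouring corners differ by a reflection
  of one Gaussian coordinate, distinct coordinates are independent, and fewer than \<open>2 ^ T\<close> transcripts are shorter
  than \<open>T\<close>.\<close>
lemma corner_information:
  assumes a: "0 < a" and t: "t = 4 * a\<^sup>2 / \<sigma>\<^sup>2" and K: "exp t \<le> K" and l: "0 < l"
  shows "(\<integral>\<^sup>+z. ennreal (\<Sum>k = 1..2 ^ J. (max 0 (sqrt (transcript_prob \<sigma> \<kappa> (corner a J S) z)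
        - sqrt (transcript_prob \<sigma> \<kappa> (corner a J (flip k S)) z)))\<^sup>2) \<partial>count_space UNIV)
    \<le> ennreal (4 * (K * t) * (real T + 1)
        + 2 ^ J * (l * long_prob \<sigma> \<kappa> T (corner a J S) + 6 * K ^ 6 * t\<^sup>2 / (4 * l)))"
proof -
  interpret prob_space "obs_law \<sigma> (corner a J S)" by (rule prob_space_obs_law[OF \<sigma>])
  define W where "W k x = 1 - exp (- 2 * corner a J S J k / \<sigma>\<^sup>2 * x (J, k))" for k and x :: "nat \<times> nat \<Rightarrow> real"
  have W: "W k \<in> borel_measurable (obs_law \<sigma> (corner a J S))" if "k \<in> {1..2 ^ J}" for k
    unfolding W_def[abs_def] measurable_obs_law
    by (intro borel_measurable_diff borel_measurable_const measurable_compose[OF _ borel_measurable_exp]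
      borel_measurable_times measurable_coeff) (use that in \<open>auto simp: coeff_index_def\<close>)
  have t': "t = 4 * (corner a J S J k)\<^sup>2 / \<sigma>\<^sup>2" if "k \<in> {1..2 ^ J}" for k
    using that by (auto simp: corner_def t)
  have t0: "0 < t" using a \<sigma> by (simp add: t)
  have K1: "1 \<le> K" using K t0 by (meson less_imp_le one_le_exp_iff order_trans)
  have "(\<integral>\<^sup>+z. ennreal (\<Sum>k = 1..2 ^ J. (max 0 (sqrt (transcript_prob \<sigma> \<kappa> (corner a J S) z)
        - sqrt (transcript_prob \<sigma> \<kappa> (corner a J (flip k S)) z)))\<^sup>2) \<partial>count_space UNIV)
    \<le> ennreal (4 * (K * t) * (ln (2 ^ T) + 1)
        + real (card {1..(2::nat) ^ J}) * (l * long_prob \<sigma> \<kappa> T (corner a J S) + (6 * K ^ 6 * t\<^sup>2) / (4 * l)))"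
  proof (rule message_information_bound[where W=W and \<kappa>=\<kappa> and A="{z. length z < T}"])
    fix k z assume k: "k \<in> {1..(2::nat) ^ J}"
    show "transcript_prob \<sigma> \<kappa> (corner a J (flip k S)) z = expectation (\<lambda>x. pmf (\<kappa> x) z * (1 - W k x))"
      unfolding transcript_prob_def corner_flip_density[OF k]
      by (subst integral_density) (use W[OF k] measurable_encoder in \<open>auto simp: W_def mult.commute measurable_obs_law
         intro!: measurable_compose[OF _ borel_measurable_exp] borel_measurable_times measurable_coeff\<close>,
         use k in \<open>auto simp: coeff_index_def\<close>)
  next
    fix k assume k: "k \<in> {1..(2::nat) ^ J}"
    have "(\<integral>\<^sup>+x. ennreal (W k x ^ 4) \<partial>obs_law \<sigma> (corner a J S)) =
      (\<integral>\<^sup>+x. (\<Prod>k\<in>{k}. ennreal ((1 - exp (- 2 * corner a J S J k / \<sigma>\<^sup>2 * x (J, k))) ^ 4)) \<partial>obs_law \<sigma> (corner a J S))"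
      by (simp add: W_def)
    also have "\<dots> = (\<integral>\<^sup>+y. ennreal ((1 - exp (- 2 * corner a J S J k / \<sigma>\<^sup>2 * y)) ^ 4)
        \<partial>density lborel (normal_density (corner a J S J k) \<sigma>))"
      using k by (subst nn_integral_obs_law_prod[OF \<sigma>,
        where f="\<lambda>k y. ennreal ((1 - exp (- 2 * corner a J S J k / \<sigma>\<^sup>2 * y)) ^ 4)"]) auto
    also have "\<dots> \<le> ennreal (6 * K ^ 6 * t\<^sup>2)"
      by (rule reflect_ratio_fourth_moment[OF \<sigma> t'[OF k] K])
    finally show "(\<integral>\<^sup>+x. ennreal (W k x ^ 4) \<partial>obs_law \<sigma> (corner a J S)) \<le> ennreal (6 * K ^ 6 * t\<^sup>2)" .
  next
    fix c :: "nat \<Rightarrow> real" assume c: "\<And>k. k \<in> {1..2 ^ J} \<Longrightarrow> 0 \<le> c k"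
    have "(\<integral>\<^sup>+x. ennreal (exp (\<Sum>k = 1..2 ^ J. c k * W k x)) \<partial>obs_law \<sigma> (corner a J S)) =
      (\<integral>\<^sup>+x. (\<Prod>k\<in>{1..2 ^ J}. ennreal (exp (c k * (1 - exp (- 2 * corner a J S J k / \<sigma>\<^sup>2 * x (J, k)))))) \<partial>obs_law \<sigma> (corner a J S))"
      by (simp add: W_def exp_sum prod_ennreal)
    also have "\<dots> = (\<Prod>k\<in>{1..2 ^ J}. \<integral>\<^sup>+y. ennreal (exp (c k * (1 - exp (- 2 * corner a J S J k / \<sigma>\<^sup>2 * y))))
        \<partial>density lborel (normal_density (corner a J S J k) \<sigma>))"
      by (subst nn_integral_obs_law_prod[OF \<sigma>,
        where f="\<lambda>k y. ennreal (exp (c k * (1 - exp (- 2 * corner a J S J k / \<sigma>\<^sup>2 * y))))"]) auto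
    also have "\<dots> \<le> (\<Prod>k\<in>{1..2 ^ J}. ennreal (exp (K * t * (c k)\<^sup>2)))"
      by (intro prod_mono_ennreal reflect_ratio_subgaussian[OF \<sigma> t' K] c) auto
    also have "\<dots> = ennreal (exp (K * t * (\<Sum>k = 1..2 ^ J. (c k)\<^sup>2)))"
      by (simp add: prod_ennreal exp_sum[symmetric] sum_distrib_left)
    finally show "(\<integral>\<^sup>+x. ennreal (exp (\<Sum>k = 1..2 ^ J. c k * W k x)) \<partial>obs_law \<sigma> (corner a J S))
       \<le> ennreal (exp (K * t * (\<Sum>k = 1..2 ^ J. (c k)\<^sup>2)))" .
  next
    have "- {z :: bool list. length z < T} = {z. T \<le> length z}" by auto
    then show "(\<integral>\<^sup>+z. ennreal (transcript_prob \<sigma> \<kappa> (corner a J S) z) * indicator (- {z. length z < T}) z \<partial>count_space UNIV)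
      \<le> ennreal (long_prob \<sigma> \<kappa> T (corner a J S))"
      using long_prob_eq[of "corner a J S" T] by simp
  next
    show "real (card {z :: bool list. length z < T}) \<le> 2 ^ T"
      using card_short_lists(2)[of T] by (metis of_nat_le_iff of_nat_numeral of_nat_power)
  qed (use W K1 t0 l card_short_lists(1) measurable_encoder in \<open>auto simp: W_def transcript_prob_def long_prob_def\<close>)
  also have "\<dots> \<le> ennreal (4 * (K * t) * (real T + 1)
        + 2 ^ J * (l * long_prob \<sigma> \<kappa> T (corner a J S) + 6 * K ^ 6 * t\<^sup>2 / (4 * l)))"
  proof -
    have "real T * ln 2 \<le> real T * 1" using ln_2_less_1 by (intro mult_left_mono) auto
    then have "4 * (K * t) * (ln (2 ^ T) + 1) \<le> 4 * (K * t) * (real T + 1)"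
      using K1 t0 by (intro mult_left_mono) (auto simp: ln_realpow)
    then show ?thesis by (intro ennreal_leI) simp
  qed
  finally show ?thesis .
qed

end

section \<open>Accurate estimation forces long transcripts\<close>

lemma dist_estimatorsD:
  assumes "e \<in> dist_estimators m" "i \<in> {1..m}"
  shows "(\<lambda>x. measure_pmf (encoder e i x)) \<in> obs_space \<rightarrow>\<^sub>M prob_algebra (count_space UNIV)"
  using assms by (auto simp: dist_estimators_def)

lemma transcripts_law_eq:
  assumes "e \<in> dist_estimators m" "0 < \<sigma>"
  shows "transcripts_law m \<sigma> e \<theta> = PiM {1..m} (\<lambda>i. density (count_space UNIV)
    (\<lambda>z. ennreal (transcript_prob \<sigma> (encoder e i) \<theta> z)))"
  unfolding transcripts_law_def
  by (intro PiM_cong refl transcript_eq_density dist_estimatorsD[OF assms(1)] assms(2)) auto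

lemma measurable_transcripts_law:
  assumes "e \<in> dist_estimators m" "0 < \<sigma>"
  shows "f \<in> borel_measurable (transcripts_law m \<sigma> e \<theta>)"
proof -
  have "transcripts_law m \<sigma> e \<theta> = density (count_space (PiE {1..m} (\<lambda>_. UNIV)))
     (\<lambda>z. \<Prod>i\<in>{1..m}. ennreal (transcript_prob \<sigma> (encoder e i) \<theta> (z i)))"
    unfolding transcripts_law_eq[OF assms]
    by (intro PiM_countable_density transcript_prob_sum dist_estimatorsD[OF assms(1)] assms(2)) auto
  then show ?thesis by simp
qed

lemma ennreal_sum_le: "ennreal (\<Sum>x\<in>A. f x) \<le> (\<Sum>x\<in>A. ennreal (f x))"
proof -
  have "ennreal (\<Sum>x\<in>A. f x) \<le> ennreal (\<Sum>x\<in>A. max 0 (f x))" by (intro ennreal_leI sum_mono) auto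
  also have "\<dots> = (\<Sum>x\<in>A. ennreal (max 0 (f x)))" by (rule sum_ennreal[symmetric]) auto
  also have "\<dots> = (\<Sum>x\<in>A. ennreal (f x))" by (intro sum.cong) (auto simp: max_def ennreal_neg)
  finally show ?thesis .
qed

lemma sum_Pow_flip:
  "k \<in> A \<Longrightarrow> (\<Sum>S\<in>Pow A. f (flip k S)) = (\<Sum>S\<in>Pow A. f S)"
  by (rule sum.reindex_bij_witness[where i="flip k" and j="flip k"]) (auto simp: flip_def)

text \<open>Summing the two-point bound over all edges of the cube turns a small risk at the corners into a lower bound for
  the total Hellinger information, which \<open>corner_information\<close> bounds from above. The involution \<open>flip k\<close> of the power
  set turns two-sided into one-sided distances.\<close>
lemma corners_require_information:
  assumes e: "e \<in> dist_estimators m" and \<sigma>: "0 < \<sigma>"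
    and a: "0 < a" and t: "t = 4 * a\<^sup>2 / \<sigma>\<^sup>2" and K: "exp t \<le> K" and l: "0 < l"
    and risk: "\<And>S. S \<subseteq> {1..2 ^ J} \<Longrightarrow> risk m \<sigma> e (corner a J S) \<le> ennreal (a\<^sup>2 * 2 ^ J / 2)"
  shows "2 ^ J * 2 ^ 2 ^ J / 4 \<le> (\<Sum>S\<in>Pow {1..2 ^ J}. \<Sum>i = 1..m. 4 * (K * t) * (real T + 1)
        + 2 ^ J * (l * long_prob \<sigma> (encoder e i) T (corner a J S) + 6 * K ^ 6 * t\<^sup>2 / (4 * l)))"
proof -
  define I where "I = {1..m}"
  define Ks where "Ks = {1..(2::nat) ^ J}"
  define U where "U = Pow Ks"
  define D where "D = (2::real) ^ J"
  define N where "N = (2::real) ^ 2 ^ J"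
  define p where "p i S z = transcript_prob \<sigma> (encoder e i) (corner a J S) z" for i S z
  \<comment> \<open>\<open>g i k S\<close> is the one-sided squared Hellinger distance for machine \<open>i\<close> along the edge in direction \<open>k\<close>.\<close>
  define x where "x i k S z = max 0 (sqrt (p i S z) - sqrt (p i (flip k S) z))" for i k S z
  define g where "g i k S = enn2real (\<integral>\<^sup>+z. ennreal ((x i k S z)\<^sup>2) \<partial>count_space UNIV)" for i k S
  define B where "B i S = 4 * (K * t) * (real T + 1)
        + D * (l * long_prob \<sigma> (encoder e i) T (corner a J S) + 6 * K ^ 6 * t\<^sup>2 / (4 * l))" for i S
  define c where "c k S = corner a J S J k" for k S
  define rk where "rk k S = (\<integral>\<^sup>+z. ennreal ((decoder e z J k - c k S)\<^sup>2) \<partial>transcripts_law m \<sigma> e (corner a J S))" for k S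
  have fin: "finite I" "finite Ks" "finite U" by (auto simp: I_def Ks_def U_def)
  have card: "real (card Ks) = D" "real (card U) = N" by (auto simp: Ks_def U_def D_def N_def card_Pow)
  have enc: "(\<lambda>x. measure_pmf (encoder e i x)) \<in> obs_space \<rightarrow>\<^sub>M prob_algebra (count_space UNIV)" if "i \<in> I" for i
    using dist_estimatorsD[OF e] that by (simp add: I_def)
  have p0: "0 \<le> p i S z" if "i \<in> I" for i S z unfolding p_def by (rule transcript_prob_nonneg[OF enc[OF that] \<sigma>])
  have p1: "(\<integral>\<^sup>+z. ennreal (p i S z) \<partial>count_space UNIV) = 1" if "i \<in> I" for i S
    unfolding p_def by (rule transcript_prob_sum[OF enc[OF that] \<sigma>])
  have g: "(\<integral>\<^sup>+z. ennreal ((x i k S z)\<^sup>2) \<partial>count_space UNIV) = ennreal (g i k S)" if i: "i \<in> I" for i k S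
  proof -
    have "(\<integral>\<^sup>+z. ennreal ((x i k S z)\<^sup>2) \<partial>count_space UNIV) \<le> (\<integral>\<^sup>+z. ennreal (p i S z) \<partial>count_space UNIV)"
    proof (intro nn_integral_mono ennreal_leI)
      fix z
      have "(x i k S z)\<^sup>2 \<le> (sqrt (p i S z))\<^sup>2"
        unfolding x_def using p0[OF i] by (intro power_mono) auto
      then show "(x i k S z)\<^sup>2 \<le> p i S z" using p0[OF i] by simp
    qed
    also have "\<dots> < top" by (simp add: p1[OF i])
    finally show ?thesis by (simp add: g_def)
  qed
  have g0: "0 \<le> g i k S" for i k S by (simp add: g_def)
  have c2: "(c k S)\<^sup>2 = a\<^sup>2" "c k (flip k S) = - c k S" if "k \<in> Ks" for k S
    using that by (auto simp: c_def corner_def flip_def Ks_def)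
  have two_point: "ennreal (4 * a\<^sup>2 * (1 - (\<Sum>i\<in>I. g i k S + g i k (flip k S)) / 2))
      \<le> rk k S + rk k (flip k S) + ennreal (2 * a\<^sup>2)" if k: "k \<in> Ks" for k S
  proof -
    have "ennreal (4 * (c k S)\<^sup>2 * (1 - (\<Sum>i\<in>I. g i k S + g i k (flip k S)) / 2))
      \<le> (\<integral>\<^sup>+z. ennreal ((decoder e z J k - c k S)\<^sup>2) \<partial>PiM I (\<lambda>i. density (count_space UNIV) (\<lambda>z. ennreal (p i S z))))
      + (\<integral>\<^sup>+z. ennreal ((decoder e z J k + c k S)\<^sup>2) \<partial>PiM I (\<lambda>i. density (count_space UNIV) (\<lambda>z. ennreal (p i (flip k S) z))))
      + ennreal (2 * (c k S)\<^sup>2)"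
    proof (rule two_point_risk_bound[OF fin(1)])
      fix i assume i: "i \<in> I"
      have "(sqrt (p i S z) - sqrt (p i (flip k S) z))\<^sup>2 = (x i k S z)\<^sup>2 + (x i k (flip k S) z)\<^sup>2" for z
        by (simp add: x_def max_def power2_eq_square algebra_simps)
      then show "(\<integral>\<^sup>+z. ennreal ((sqrt (p i S z) - sqrt (p i (flip k S) z))\<^sup>2) \<partial>count_space UNIV)
        = ennreal (g i k S + g i k (flip k S))"
        using g0 by (simp add: nn_integral_add g[OF i])
    qed (use p0 p1 g0 in auto)
    then show ?thesis unfolding rk_def transcripts_law_eq[OF e \<sigma>]
      by (simp add: c2[OF k] I_def p_def)
  qed
  have rk: "(\<Sum>k\<in>Ks. rk k S) \<le> ennreal (a\<^sup>2 * D / 2)" if "S \<in> U" for S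
  proof -
    have "(\<Sum>k\<in>Ks. rk k S) = (\<integral>\<^sup>+z. ennreal (\<Sum>k\<in>Ks. (decoder e z J k - c k S)\<^sup>2) \<partial>transcripts_law m \<sigma> e (corner a J S))"
      unfolding rk_def by (subst nn_integral_sum[symmetric]) (auto intro: measurable_transcripts_law[OF e \<sigma>])
    also have "\<dots> \<le> risk m \<sigma> e (corner a J S)"
      unfolding risk_def
    proof (rule nn_integral_mono)
      fix z
      show "ennreal (\<Sum>k\<in>Ks. (decoder e z J k - c k S)\<^sup>2) \<le> sq_loss (decoder e z) (corner a J S)"
        unfolding sq_loss_def Ks_def c_def
        using sum_le_suminf[OF summableI, of "{J}" "\<lambda>j. ennreal (\<Sum>k = 1..2 ^ j. (decoder e z j k - corner a J S j k)\<^sup>2)"]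
        by simp
    qed
    also have "\<dots> \<le> ennreal (a\<^sup>2 * D / 2)" unfolding D_def using that by (intro risk) (auto simp: U_def Ks_def)
    finally show ?thesis .
  qed
  have flip_sum_real: "(\<Sum>S\<in>U. f (flip k S)) = (\<Sum>S\<in>U. f S)" if "k \<in> Ks" for k and f :: "nat set \<Rightarrow> real"
    unfolding U_def by (rule sum_Pow_flip[OF that])
  have flip_sum: "(\<Sum>S\<in>U. f (flip k S)) = (\<Sum>S\<in>U. f S)" if "k \<in> Ks" for k and f :: "nat set \<Rightarrow> ennreal"
    unfolding U_def by (rule sum_Pow_flip[OF that])
  define X where "X = (\<Sum>S\<in>U. \<Sum>k\<in>Ks. \<Sum>i\<in>I. g i k S)"
  have Xflip: "(\<Sum>S\<in>U. \<Sum>k\<in>Ks. \<Sum>i\<in>I. g i k (flip k S)) = X"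
  proof -
    have "(\<Sum>S\<in>U. \<Sum>k\<in>Ks. \<Sum>i\<in>I. g i k (flip k S)) = (\<Sum>k\<in>Ks. \<Sum>S\<in>U. \<Sum>i\<in>I. g i k (flip k S))"
      by (rule sum.swap)
    also have "\<dots> = (\<Sum>k\<in>Ks. \<Sum>S\<in>U. \<Sum>i\<in>I. g i k S)"
      by (intro sum.cong refl flip_sum_real)
    also have "\<dots> = X" unfolding X_def by (rule sum.swap)
    finally show ?thesis .
  qed
  have "ennreal (4 * a\<^sup>2 * (D * N - X)) = ennreal (\<Sum>S\<in>U. \<Sum>k\<in>Ks. 4 * a\<^sup>2 * (1 - (\<Sum>i\<in>I. g i k S + g i k (flip k S)) / 2))"
  proof -
    have "(\<Sum>S\<in>U. \<Sum>k\<in>Ks. 4 * a\<^sup>2 * (1 - (\<Sum>i\<in>I. g i k S + g i k (flip k S)) / 2))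
      = 4 * a\<^sup>2 * (\<Sum>S\<in>U. \<Sum>k\<in>Ks. 1 - (\<Sum>i\<in>I. g i k S + g i k (flip k S)) / 2)"
      by (simp add: sum_distrib_left)
    also have "(\<Sum>S\<in>U. \<Sum>k\<in>Ks. 1 - (\<Sum>i\<in>I. g i k S + g i k (flip k S)) / 2)
      = D * N - ((\<Sum>S\<in>U. \<Sum>k\<in>Ks. \<Sum>i\<in>I. g i k S) + (\<Sum>S\<in>U. \<Sum>k\<in>Ks. \<Sum>i\<in>I. g i k (flip k S))) / 2"
      by (simp add: sum_subtractf sum.distrib card sum_divide_distrib[symmetric] mult.commute)
    also have "\<dots> = D * N - X" unfolding Xflip X_def[symmetric] by simp
    finally show ?thesis by simp
  qed
  also have "\<dots> \<le> (\<Sum>S\<in>U. \<Sum>k\<in>Ks. ennreal (4 * a\<^sup>2 * (1 - (\<Sum>i\<in>I. g i k S + g i k (flip k S)) / 2)))"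
    by (rule order_trans[OF ennreal_sum_le]) (intro sum_mono ennreal_sum_le)
  also have "\<dots> \<le> (\<Sum>S\<in>U. \<Sum>k\<in>Ks. rk k S + rk k (flip k S) + ennreal (2 * a\<^sup>2))"
    by (intro sum_mono two_point)
  also have "\<dots> = (\<Sum>S\<in>U. \<Sum>k\<in>Ks. rk k S) + (\<Sum>S\<in>U. \<Sum>k\<in>Ks. rk k (flip k S)) + (\<Sum>S\<in>U. \<Sum>k\<in>Ks. ennreal (2 * a\<^sup>2))"
    by (simp add: sum.distrib)
  also have "(\<Sum>S\<in>U. \<Sum>k\<in>Ks. rk k (flip k S)) = (\<Sum>S\<in>U. \<Sum>k\<in>Ks. rk k S)"
  proof -
    have "(\<Sum>S\<in>U. \<Sum>k\<in>Ks. rk k (flip k S)) = (\<Sum>k\<in>Ks. \<Sum>S\<in>U. rk k (flip k S))" by (rule sum.swap)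
    also have "\<dots> = (\<Sum>k\<in>Ks. \<Sum>S\<in>U. rk k S)" by (intro sum.cong refl flip_sum)
    also have "\<dots> = (\<Sum>S\<in>U. \<Sum>k\<in>Ks. rk k S)" by (rule sum.swap)
    finally show ?thesis .
  qed
  also have "(\<Sum>S\<in>U. \<Sum>k\<in>Ks. rk k S) + (\<Sum>S\<in>U. \<Sum>k\<in>Ks. rk k S) + (\<Sum>S\<in>U. \<Sum>k\<in>Ks. ennreal (2 * a\<^sup>2))
     \<le> (\<Sum>S\<in>U. ennreal (a\<^sup>2 * D / 2)) + (\<Sum>S\<in>U. ennreal (a\<^sup>2 * D / 2)) + (\<Sum>S\<in>U. \<Sum>k\<in>Ks. ennreal (2 * a\<^sup>2))"
    by (intro add_mono sum_mono rk order_refl)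
  also have "\<dots> = ennreal ((\<Sum>S\<in>U. a\<^sup>2 * D / 2) + (\<Sum>S\<in>U. a\<^sup>2 * D / 2) + (\<Sum>S\<in>U. \<Sum>k\<in>Ks. 2 * a\<^sup>2))"
    by (subst ennreal_plus; (subst ennreal_plus)?) (auto intro!: sum_nonneg simp: D_def sum_ennreal sum_nonneg simp del: sum_constant)
  also have "(\<Sum>S\<in>U. a\<^sup>2 * D / 2) + (\<Sum>S\<in>U. a\<^sup>2 * D / 2) + (\<Sum>S\<in>U. \<Sum>k\<in>Ks. 2 * a\<^sup>2) = 3 * a\<^sup>2 * D * N"
    by (simp add: card algebra_simps)
  finally have "4 * a\<^sup>2 * (D * N - X) \<le> 3 * a\<^sup>2 * D * N"
    by (subst (asm) ennreal_le_iff) (auto simp: D_def N_def)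
  then have "a\<^sup>2 * (D * N / 4) \<le> a\<^sup>2 * X" by (simp add: algebra_simps)
  then have "D * N / 4 \<le> X" using a by simp
  also have "X = (\<Sum>S\<in>U. \<Sum>i\<in>I. \<Sum>k\<in>Ks. g i k S)" unfolding X_def by (intro sum.cong refl sum.swap)
  also have "\<dots> \<le> (\<Sum>S\<in>U. \<Sum>i\<in>I. B i S)"
  proof (intro sum_mono)
    fix S i assume i: "i \<in> I"
    have "ennreal (\<Sum>k\<in>Ks. g i k S) = (\<Sum>k\<in>Ks. \<integral>\<^sup>+z. ennreal ((x i k S z)\<^sup>2) \<partial>count_space UNIV)"
      using g0 by (simp add: g[OF i])
    also have "\<dots> = (\<integral>\<^sup>+z. ennreal (\<Sum>k\<in>Ks. (x i k S z)\<^sup>2) \<partial>count_space UNIV)"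
      by (subst nn_integral_sum[symmetric]) auto
    also have "\<dots> \<le> ennreal (B i S)"
      unfolding x_def p_def B_def Ks_def D_def by (rule corner_information[OF enc[OF i] \<sigma> a t K l])
    finally show "(\<Sum>k\<in>Ks. g i k S) \<le> B i S"
    proof (subst (asm) ennreal_le_iff)
      have "0 \<le> K" using K by (meson exp_ge_zero order_trans)
      then show "0 \<le> B i S" using t l by (simp add: B_def D_def long_prob_def)
    qed
  qed
  finally show ?thesis unfolding D_def N_def U_def Ks_def I_def B_def .
qed

text \<open>The condition on \<open>T\<close> leaves the short transcripts too little information, at most one sixteenth of
  \<open>D = 2 ^ J\<close> on average over the corners, so the long ones must
  supply the rest. Since \<open>m * t\<close> does not depend on \<open>m\<close>, neither does the constant.\<close>
lemma long_transcripts: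
  assumes e: "e \<in> dist_estimators m" and m: "1 \<le> m" and \<sigma>: "0 < \<sigma>" and \<delta>: "0 < \<delta>"
    and a: "a = \<delta> * \<sigma> / sqrt m" and K: "K = exp (4 * \<delta>\<^sup>2)"
    and T: "256 * K * \<delta>\<^sup>2 * (real T + 1) \<le> 2 ^ J"
    and risk: "\<And>S. S \<subseteq> {1..2 ^ J} \<Longrightarrow> risk m \<sigma> e (corner a J S) \<le> ennreal (a\<^sup>2 * 2 ^ J / 2)"
  shows "2 ^ 2 ^ J * (m / (3072 * K ^ 6 * \<delta> ^ 4)) \<le>
    (\<Sum>S\<in>Pow {1..2 ^ J}. \<Sum>i = 1..m. long_prob \<sigma> (encoder e i) T (corner a J S))"
proof -
  define t where "t = 4 * \<delta>\<^sup>2 / m"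
  define D where "D = (2::real) ^ J"
  define N where "N = (2::real) ^ 2 ^ J"
  \<comment> \<open>Chosen so that the fourth-moment term also takes at most one sixteenth of \<open>D\<close>.\<close>
  define L where "L = 96 * K ^ 6 * \<delta>\<^sup>2"
  define Y where "Y = (\<Sum>S\<in>Pow {1..2 ^ J}. \<Sum>i = 1..m. long_prob \<sigma> (encoder e i) T (corner a J S))"
  have pos: "0 < a" "0 < t" "0 < D" "0 < N" "0 < L" "0 < K" using m \<sigma> \<delta> by (auto simp: a t_def D_def N_def L_def K)
  have t: "t = 4 * a\<^sup>2 / \<sigma>\<^sup>2" using m \<sigma> by (simp add: t_def a power_mult_distrib power_divide)
  have mt: "m * t = 4 * \<delta>\<^sup>2" using m by (simp add: t_def)
  have "t \<le> 4 * \<delta>\<^sup>2" using m mult_right_mono[of 1 "real m" t] pos(2) mt by simp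
  then have K': "exp t \<le> K" by (simp add: K)
  have "D * N / 4 \<le> (\<Sum>S\<in>Pow {1..2 ^ J}. \<Sum>i = 1..m. 4 * (K * t) * (real T + 1)
        + D * (t * L * long_prob \<sigma> (encoder e i) T (corner a J S) + 6 * K ^ 6 * t\<^sup>2 / (4 * (t * L))))"
    unfolding D_def N_def by (rule corners_require_information[OF e \<sigma> pos(1) t K' _ risk]) (use pos in auto)
  also have "\<dots> = N * (m * (4 * (K * t) * (real T + 1))) + D * (t * L * Y + N * (m * (6 * K ^ 6 * t\<^sup>2 / (4 * (t * L)))))"
    by (simp add: sum.distrib card_Pow sum_distrib_left[symmetric] Y_def N_def distrib_left distrib_right)
  also have "m * (4 * (K * t) * (real T + 1)) = 16 * K * \<delta>\<^sup>2 * (real T + 1)"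
  proof -
    have "m * (4 * (K * t) * (real T + 1)) = (m * t) * (4 * K * (real T + 1))" by simp
    then show ?thesis unfolding mt by simp
  qed
  also have "m * (6 * K ^ 6 * t\<^sup>2 / (4 * (t * L))) = 1 / 16"
  proof -
    have "m * (6 * K ^ 6 * t\<^sup>2 / (4 * (t * L))) = (m * t) * (6 * K ^ 6) / (4 * L)"
      using pos by (simp add: power2_eq_square)
    also have "\<dots> = 1 / 16" unfolding mt using pos \<delta> by (simp add: L_def)
    finally show ?thesis .
  qed
  also have "N * (16 * K * \<delta>\<^sup>2 * (real T + 1)) \<le> N * (D / 16)"
    using T pos by (intro mult_left_mono) (auto simp: D_def)
  finally have "D * (N / 8) \<le> D * (t * L * Y)" by (simp add: algebra_simps)
  then have "N / 8 \<le> t * L * Y" using pos by simp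
  then have "N / (8 * (t * L)) \<le> Y" using pos by (simp add: field_simps)
  moreover have "N / (8 * (t * L)) = N * (m / (3072 * K ^ 6 * \<delta> ^ 4))"
    using m pos \<delta> by (simp add: t_def L_def power2_eq_square power4_eq_xxxx)
  ultimately show ?thesis by (simp add: Y_def N_def)
qed

text \<open>Markov's inequality for each machine.\<close>
lemma expected_cost_ge:
  assumes e: "e \<in> dist_estimators m" and \<sigma>: "0 < \<sigma>"
  shows "ennreal (T * (\<Sum>i = 1..m. long_prob \<sigma> (encoder e i) T \<theta>)) \<le> expected_cost m \<sigma> e \<theta>"
proof -
  let ?P = "transcripts_law m \<sigma> e \<theta>"
  let ?Q = "\<lambda>i. density (count_space UNIV) (\<lambda>z. ennreal (transcript_prob \<sigma> (encoder e i) \<theta> z))"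
  note enc = dist_estimatorsD[OF e]
  have prob: "prob_space (?Q i)" if "i \<in> {1..m}" for i
    using transcript_prob_sum[OF enc[OF that] \<sigma>] by (intro prob_spaceI) (simp add: emeasure_density)
  have lp: "0 \<le> long_prob \<sigma> (encoder e i) T \<theta>" for i by (simp add: long_prob_def)
  have comp: "(\<integral>\<^sup>+z. indicator {w. T \<le> length w} (z i) \<partial>?P) = ennreal (long_prob \<sigma> (encoder e i) T \<theta>)" if i: "i \<in> {1..m}" for i
  proof -
    have "(\<integral>\<^sup>+z. indicator {w. T \<le> length w} (z i) \<partial>?P) = (\<integral>\<^sup>+w. indicator {w. T \<le> length w} w \<partial>distr ?P (?Q i) (\<lambda>z. z i))"
      using i by (subst nn_integral_distr) (auto simp: transcripts_law_eq[OF e \<sigma>])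
    also have "distr ?P (?Q i) (\<lambda>z. z i) = ?Q i"
      unfolding transcripts_law_eq[OF e \<sigma>] by (rule distr_PiM_component[OF prob i])
    also have "(\<integral>\<^sup>+w. indicator {w. T \<le> length w} w \<partial>?Q i) = ennreal (long_prob \<sigma> (encoder e i) T \<theta>)"
      unfolding long_prob_eq[OF enc[OF i] \<sigma>, symmetric] by (subst nn_integral_density) auto
    finally show ?thesis .
  qed
  have "ennreal (T * (\<Sum>i = 1..m. long_prob \<sigma> (encoder e i) T \<theta>)) = of_nat T * (\<Sum>i = 1..m. ennreal (long_prob \<sigma> (encoder e i) T \<theta>))"
    using lp by (simp add: ennreal_mult sum_nonneg ennreal_of_nat_eq_real_of_nat)
  also have "\<dots> = of_nat T * (\<Sum>i = 1..m. \<integral>\<^sup>+z. indicator {w. T \<le> length w} (z i) \<partial>?P)"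
    by (simp add: comp)
  also have "\<dots> = (\<integral>\<^sup>+z. of_nat T * (\<Sum>i = 1..m. indicator {w. T \<le> length w} (z i)) \<partial>?P)"
    by (subst nn_integral_cmult, rule measurable_transcripts_law[OF e \<sigma>], subst nn_integral_sum)
       (auto intro: measurable_transcripts_law[OF e \<sigma>])
  also have "\<dots> \<le> expected_cost m \<sigma> e \<theta>"
    unfolding expected_cost_def
  proof (rule nn_integral_mono)
    fix z :: "nat \<Rightarrow> bool list"
    have "of_nat T * (\<Sum>i = 1..m. indicator {w. T \<le> length w} (z i) :: ennreal) = (\<Sum>i = 1..m. of_nat T * indicator {w. T \<le> length w} (z i))"
      by (rule sum_distrib_left)
    also have "\<dots> \<le> (\<Sum>i = 1..m. of_nat (length (z i)))"
      by (intro sum_mono) (auto simp: indicator_def)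
    finally show "of_nat T * (\<Sum>i = 1..m. indicator {w. T \<le> length w} (z i)) \<le> (of_nat (\<Sum>i = 1..m. length (z i)) :: ennreal)"
      by simp
  qed
  finally show ?thesis .
qed

text \<open>No transcript is empty. This bound covers all parameter ranges in which the claimed cost is at most a constant
  multiple of the number of machines.\<close>
lemma expected_cost_ge_machines:
  assumes e: "e \<in> dist_estimators m" and \<sigma>: "0 < \<sigma>"
  shows "ennreal m \<le> expected_cost m \<sigma> e \<theta>"
proof -
  interpret prob_space "obs_law \<sigma> \<theta>" by (rule prob_space_obs_law[OF \<sigma>])
  have "long_prob \<sigma> (encoder e i) 1 \<theta> = 1" if i: "i \<in> {1..m}" for i
  proof -
    have "\<exists>W. uniquely_decodable W \<and> (\<forall>w\<in>W. 1 \<le> length w) \<and>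
        (\<forall>x\<in>space obs_space. set_pmf (encoder e i x) \<subseteq> W)"
      using e i by (simp add: dist_estimators_def)
    then obtain W where W: "\<forall>w\<in>W. 1 \<le> length w" "\<forall>x\<in>space obs_space. set_pmf (encoder e i x) \<subseteq> W"
      by (elim exE conjE)
    have "measure (measure_pmf (encoder e i x)) {z. 1 \<le> length z} = 1" if "x \<in> space (obs_law \<sigma> \<theta>)" for x
      by (subst measure_pmf.prob_eq_1) (use W that in \<open>auto simp: AE_measure_pmf_iff space_obs_law\<close>)
    then have "long_prob \<sigma> (encoder e i) 1 \<theta> = (\<integral>x. 1 \<partial>obs_law \<sigma> \<theta>)"
      unfolding long_prob_def by (intro Bochner_Integration.integral_cong refl) simp
    then show ?thesis by (simp add: prob_space)
  qed
  then show ?thesis using expected_cost_ge[OF e \<sigma>, of 1 \<theta>] by simp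
qed

section \<open>Weak dense signals are invisible to a single machine\<close>

lemma cosh_le_exp_square:
  fixes x :: real assumes "\<bar>x\<bar> \<le> 1" shows "cosh x \<le> exp (x\<^sup>2)"
proof -
  have "exp x \<le> 1 + x + x\<^sup>2" "exp (- x) \<le> 1 - x + x\<^sup>2"
    using exp_le_quadratic[of x] exp_le_quadratic[of "- x"] assms by auto
  then have "cosh x \<le> 1 + x\<^sup>2" by (simp add: cosh_field_def)
  also have "\<dots> \<le> exp (x\<^sup>2)" by (rule exp_ge_add_one_self)
  finally show ?thesis .
qed

text \<open>The likelihood ratio \<open>W\<close> of the uniform mixture of corners against the zero signal is a product of independent
  factors with second moment \<open>cosh \<rho>\<close>. Its variance is therefore of order \<open>D * \<rho>\<^sup>2\<close> rather than
  \<open>D * \<rho>\<close>, which leaves a cube with as many as order \<open>m\<^sup>2\<close> coordinates of size \<open>\<sigma> / sqrt m\<close> undetectable from the data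
  of one machine.\<close>
lemma mixture_long_prob_le:
  assumes \<kappa>: "(\<lambda>x. measure_pmf (\<kappa> x)) \<in> obs_space \<rightarrow>\<^sub>M prob_algebra (count_space UNIV)"
    and \<sigma>: "0 < \<sigma>" and \<rho>: "\<rho> = a\<^sup>2 / \<sigma>\<^sup>2" "\<rho> \<le> 1" and l: "0 < l"
  shows "(\<Sum>S\<in>Pow {1..2 ^ J}. long_prob \<sigma> \<kappa> T (corner a J S)) / 2 ^ 2 ^ J
    \<le> long_prob \<sigma> \<kappa> T (\<lambda>_ _. 0) + l + (exp (2 ^ J * \<rho>\<^sup>2) - 1) / (4 * l)"
proof -
  define M where "M = obs_law \<sigma> (\<lambda>_ _. 0)"
  define N0 where "N0 = density lborel (normal_density 0 \<sigma>)"
  define r where "r s y = exp (s / \<sigma>\<^sup>2 * y) * exp (- s\<^sup>2 / (2 * \<sigma>\<^sup>2))" for s y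
  define w where "w y = (r a y + r (- a) y) / 2" for y
  define W where "W x = (\<Prod>k\<in>{1..2 ^ J}. w (x (J, k)))" for x :: "nat \<times> nat \<Rightarrow> real"
  define R where "R S x = (\<Prod>k\<in>{1..2 ^ J}. r (corner a J S J k) (x (J, k)))" for S and x :: "nat \<times> nat \<Rightarrow> real"
  define h where "h x = measure (measure_pmf (\<kappa> x)) {z. T \<le> length z}" for x
  interpret prob_space M unfolding M_def by (rule prob_space_obs_law[OF \<sigma>])
  interpret N0: prob_space N0 unfolding N0_def by (rule prob_space_normal_density[OF \<sigma>])
  have r0: "0 \<le> r s y" for s y by (simp add: r_def)
  have w0: "0 \<le> w y" for y by (simp add: w_def r0)
  have [measurable]: "r s \<in> borel_measurable borel" "w \<in> borel_measurable borel" for s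
    by (simp_all add: r_def[abs_def] w_def[abs_def])
  have coord: "(\<lambda>x. x (J, k)) \<in> borel_measurable M" if "k \<in> {1..2 ^ J}" for k
    unfolding M_def measurable_obs_law using that by (intro measurable_coeff) (auto simp: coeff_index_def)
  have Rm: "R S \<in> borel_measurable M" for S unfolding R_def[abs_def]
    by (intro borel_measurable_prod measurable_compose[OF coord]) auto
  have Wm: "W \<in> borel_measurable M" unfolding W_def[abs_def]
    by (intro borel_measurable_prod measurable_compose[OF coord]) auto
  have R0: "0 \<le> R S x" for S x by (auto simp: R_def intro!: prod_nonneg r0)
  have W0: "0 \<le> W x" for x by (auto simp: W_def intro!: prod_nonneg w0)
  have hm: "h \<in> borel_measurable M" unfolding h_def[abs_def] M_def by (rule measurable_encoder_measure[OF \<kappa> \<sigma>])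
  have h01: "0 \<le> h x" "h x \<le> 1" for x by (auto simp: h_def)
  have tilt: "normal_density s \<sigma> y = normal_density 0 \<sigma> y * r s y" for s y
  proof -
    have "- (y - s)\<^sup>2 / (2 * \<sigma>\<^sup>2) = - (y - 0)\<^sup>2 / (2 * \<sigma>\<^sup>2) + (s / \<sigma>\<^sup>2 * y + - s\<^sup>2 / (2 * \<sigma>\<^sup>2))"
      using \<sigma> by (simp add: field_simps power2_eq_square)
    then have "exp (- (y - s)\<^sup>2 / (2 * \<sigma>\<^sup>2)) = exp (- (y - 0)\<^sup>2 / (2 * \<sigma>\<^sup>2)) * r s y"
      unfolding r_def exp_add[symmetric] by simp
    then show ?thesis by (simp add: normal_density_def)
  qed
  have dens: "obs_law \<sigma> (corner a J S) = density M (\<lambda>x. ennreal (R S x))" for S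
    unfolding M_def R_def
  proof (rule obs_law_eq_density[OF \<sigma> order_refl])
    show "normal_density (corner a J S J k) \<sigma> y = normal_density 0 \<sigma> y * r (corner a J S J k) y" for k y
      by (rule tilt)
  qed (auto simp: r0 corner_def)
  have iR: "integrable M (R S)" for S
  proof -
    interpret S: prob_space "obs_law \<sigma> (corner a J S)" by (rule prob_space_obs_law[OF \<sigma>])
    have "(\<integral>\<^sup>+x. ennreal (R S x) \<partial>M) = (\<integral>\<^sup>+x. 1 \<partial>obs_law \<sigma> (corner a J S))"
      unfolding dens using Rm by (subst nn_integral_density) auto
    also have "\<dots> = 1" by (simp add: S.emeasure_space_1)
    finally show ?thesis using Rm R0 by (intro integrableI_nonneg) auto
  qed
  have ihR: "integrable M (\<lambda>x. R S x * h x)" for S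
    using Rm hm h01 R0 by (intro Bochner_Integration.integrable_bound[OF iR[of S]]) (auto simp: abs_mult mult_right_le_one_le)
  have lpS: "long_prob \<sigma> \<kappa> T (corner a J S) = expectation (\<lambda>x. R S x * h x)" for S
    unfolding long_prob_def h_def[symmetric] dens using hm Rm R0 by (subst integral_density) auto
  have mix: "(\<Sum>S\<in>Pow {1..2 ^ J}. R S x) / 2 ^ 2 ^ J = W x" for x
  proof -
    have "W x = (\<Prod>k\<in>{1..2 ^ J}. r a (x (J, k)) + r (- a) (x (J, k))) / (\<Prod>k\<in>{1..(2::nat) ^ J}. 2)"
      unfolding W_def w_def by (rule prod_dividef)
    also have "(\<Prod>k\<in>{1..2 ^ J}. r a (x (J, k)) + r (- a) (x (J, k))) = (\<Sum>S\<in>Pow {1..2 ^ J}. R S x)"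
      unfolding prod_add[OF finite_atLeastAtMost]
    proof (rule sum.cong[OF refl])
      fix S assume S: "S \<in> Pow {1..(2::nat) ^ J}"
      have "R S x = (\<Prod>k\<in>S \<union> ({1..2 ^ J} - S). r (corner a J S J k) (x (J, k)))"
        unfolding R_def using S by (intro prod.cong) auto
      also have "\<dots> = (\<Prod>k\<in>S. r (corner a J S J k) (x (J, k))) * (\<Prod>k\<in>{1..2 ^ J} - S. r (corner a J S J k) (x (J, k)))"
        using S by (intro prod.union_disjoint) (auto intro: finite_subset)
      also have "\<dots> = (\<Prod>k\<in>S. r a (x (J, k))) * (\<Prod>k\<in>{1..2 ^ J} - S. r (- a) (x (J, k)))"
        using S by (intro arg_cong2[where f="(*)"] prod.cong) (auto simp: corner_def)
      finally show "(\<Prod>k\<in>S. r a (x (J, k))) * (\<Prod>k\<in>{1..2 ^ J} - S. r (- a) (x (J, k))) = R S x" ..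
    qed
    finally show ?thesis by simp
  qed
  have iW: "integrable M W" and ihW: "integrable M (\<lambda>x. W x * h x)"
    unfolding mix[symmetric] by (auto intro!: integrable_divide Bochner_Integration.integrable_sum iR ihR
      simp: sum_distrib_right)
  have EW: "expectation W = 1"
  proof -
    have "expectation (R S) = 1" for S
    proof -
      interpret S: prob_space "obs_law \<sigma> (corner a J S)" by (rule prob_space_obs_law[OF \<sigma>])
      have "(1::real) = integral\<^sup>L (obs_law \<sigma> (corner a J S)) (\<lambda>_. 1)" by (simp add: S.prob_space)
      also have "\<dots> = expectation (R S)" unfolding dens using Rm R0 by (subst integral_density) auto
      finally show ?thesis ..
    qed
    then show ?thesis unfolding mix[symmetric] using iR by (simp add: card_Pow)
  qed
  have second: "(\<integral>\<^sup>+x. ennreal ((W x)\<^sup>2) \<partial>M) \<le> ennreal (exp (2 ^ J * \<rho>\<^sup>2))"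
  proof -
    have "(\<integral>\<^sup>+x. ennreal ((W x)\<^sup>2) \<partial>M) = (\<integral>\<^sup>+x. (\<Prod>k\<in>{1..2 ^ J}. ennreal ((w (x (J, k)))\<^sup>2)) \<partial>M)"
      by (simp add: W_def prod_power_distrib prod_ennreal)
    also have "\<dots> = (\<Prod>k\<in>{1..(2::nat) ^ J}. \<integral>\<^sup>+y. ennreal ((w y)\<^sup>2) \<partial>N0)"
      unfolding M_def N0_def by (subst nn_integral_obs_law_prod[OF \<sigma>, where f="\<lambda>_ y. ennreal ((w y)\<^sup>2)"]) auto
    also have "\<dots> \<le> (\<Prod>k\<in>{1..(2::nat) ^ J}. ennreal (exp (\<rho>\<^sup>2)))"
    proof (rule prod_mono_ennreal)
      have w2: "(w y)\<^sup>2 = exp (- \<rho>) * (exp ((2 * a / \<sigma>\<^sup>2) * y) + exp ((- 2 * a / \<sigma>\<^sup>2) * y) + 2) / 4" for y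
      proof -
        define u v where "u = exp (a / \<sigma>\<^sup>2 * y)" and "v = exp (- \<rho> / 2)"
        have 1: "exp (- a / \<sigma>\<^sup>2 * y) = 1 / u" by (simp add: u_def exp_minus field_simps)
        have 2: "exp (- a\<^sup>2 / (2 * \<sigma>\<^sup>2)) = v" by (simp add: v_def \<rho>)
        have 3: "exp (- \<rho>) = v\<^sup>2" by (simp add: v_def power2_eq_square exp_add[symmetric])
        have 4: "exp ((2 * a / \<sigma>\<^sup>2) * y) = u\<^sup>2" by (simp add: u_def power2_eq_square exp_add[symmetric])
        have 5: "exp ((- 2 * a / \<sigma>\<^sup>2) * y) = 1 / u\<^sup>2" by (simp add: u_def power2_eq_square exp_add[symmetric] exp_minus field_simps)
        have u: "u \<noteq> 0" by (simp add: u_def)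
        have wy: "w y = v * (u + 1 / u) / 2"
          unfolding w_def r_def power2_minus u_def[symmetric] 1 2 by (simp add: field_simps)
        show ?thesis unfolding wy 3 4 5 using u by (simp add: field_simps power2_eq_square)
      qed
      have i: "integrable N0 (\<lambda>y. exp ((2 * a / \<sigma>\<^sup>2) * y))" "integrable N0 (\<lambda>y. exp ((- 2 * a / \<sigma>\<^sup>2) * y))"
        unfolding N0_def by (rule normal_exp_moment[OF \<sigma>])+
      have m2: "0 * (2 * a / \<sigma>\<^sup>2) + \<sigma>\<^sup>2 * (2 * a / \<sigma>\<^sup>2)\<^sup>2 / 2 = 2 * \<rho>"
        "0 * (- 2 * a / \<sigma>\<^sup>2) + \<sigma>\<^sup>2 * (- 2 * a / \<sigma>\<^sup>2)\<^sup>2 / 2 = 2 * \<rho>"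
        using \<sigma> by (simp_all add: \<rho> field_simps power2_eq_square)
      have "(\<integral>\<^sup>+y. ennreal ((w y)\<^sup>2) \<partial>N0) = ennreal (integral\<^sup>L N0 (\<lambda>y. (w y)\<^sup>2))"
        using i by (intro nn_integral_eq_integral) (auto simp: w2)
      also have "integral\<^sup>L N0 (\<lambda>y. (w y)\<^sup>2) = exp (- \<rho>) * (exp (2 * \<rho>) + exp (2 * \<rho>) + 2) / 4"
        unfolding w2 using i normal_exp_moment(2)[OF \<sigma>, of 0 "2 * a / \<sigma>\<^sup>2"] normal_exp_moment(2)[OF \<sigma>, of 0 "- 2 * a / \<sigma>\<^sup>2"]
        unfolding m2
        by (simp add: N0_def[symmetric] N0.prob_space)
      also have "\<dots> = cosh \<rho>"
        by (simp add: cosh_field_def field_simps exp_add[symmetric])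
      also have "\<dots> \<le> exp (\<rho>\<^sup>2)" using \<rho> by (intro cosh_le_exp_square) auto
      finally show "(\<integral>\<^sup>+y. ennreal ((w y)\<^sup>2) \<partial>N0) \<le> ennreal (exp (\<rho>\<^sup>2))" by (simp add: ennreal_leI)
    qed
    also have "\<dots> = ennreal (exp (2 ^ J * \<rho>\<^sup>2))"
      by (simp add: ennreal_power exp_of_nat_mult[symmetric])
    finally show ?thesis .
  qed
  have iW2: "integrable M (\<lambda>x. (W x)\<^sup>2)"
    using second Wm by (intro integrableI_nonneg) (auto simp: le_less_trans)
  have EW2: "expectation (\<lambda>x. (W x)\<^sup>2) \<le> exp (2 ^ J * \<rho>\<^sup>2)"
    using second Wm by (subst integral_eq_nn_integral) (auto intro!: enn2real_leI)
  have ih: "integrable M h" using hm h01 by (intro integrable_const_bound[of _ 1]) auto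
  have "(\<Sum>S\<in>Pow {1..2 ^ J}. long_prob \<sigma> \<kappa> T (corner a J S)) / 2 ^ 2 ^ J = expectation (\<lambda>x. W x * h x)"
    unfolding lpS mix[symmetric] using ihR by (simp add: sum_distrib_right)
  also have "\<dots> \<le> expectation (\<lambda>x. h x + l + ((W x)\<^sup>2 - 2 * W x + 1) / (4 * l))"
  proof (rule integral_mono)
    fix x
    have "0 \<le> (2 * l - (W x - 1))\<^sup>2 / (4 * l)" using l by simp
    also have "\<dots> = (l + ((W x)\<^sup>2 - 2 * W x + 1) / (4 * l)) - (W x - 1)"
      using l by (simp add: field_simps power2_eq_square)
    finally have y: "W x - 1 \<le> l + ((W x)\<^sup>2 - 2 * W x + 1) / (4 * l)" by simp
    have "(W x)\<^sup>2 - 2 * W x + 1 = (W x - 1)\<^sup>2" by (simp add: power2_diff)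
    then have y0: "0 \<le> l + ((W x)\<^sup>2 - 2 * W x + 1) / (4 * l)" using l by simp
    have "h x * (W x - 1) \<le> h x * (l + ((W x)\<^sup>2 - 2 * W x + 1) / (4 * l))" using y h01 by (intro mult_left_mono)
    also have "\<dots> \<le> l + ((W x)\<^sup>2 - 2 * W x + 1) / (4 * l)" using y0 h01 by (intro mult_left_le_one_le)
    finally show "W x * h x \<le> h x + l + ((W x)\<^sup>2 - 2 * W x + 1) / (4 * l)" by (simp add: algebra_simps)
  qed (use ihW ih iW iW2 in auto)
  also have "\<dots> = expectation h + l + (expectation (\<lambda>x. (W x)\<^sup>2) - 1) / (4 * l)"
    using ih iW iW2 by (simp add: EW prob_space)
  also have "\<dots> \<le> expectation h + l + (exp (2 ^ J * \<rho>\<^sup>2) - 1) / (4 * l)"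
    using EW2 l by (intro add_left_mono divide_right_mono) auto
  finally show ?thesis by (simp add: long_prob_def h_def[abs_def] M_def)
qed

section \<open>Besov balls contain the corners\<close>

lemma besov_norm_single_level:
  assumes q: "1 < q" and v: "0 \<le> v" "besov_level \<alpha> p \<theta> J = v"
    and zero: "\<And>j. j \<noteq> J \<Longrightarrow> besov_level \<alpha> p \<theta> j = 0"
  shows "besov_norm \<alpha> p q \<theta> = ereal v"
proof (cases q)
  case PInf
  have "(SUP j. ereal (besov_level \<alpha> p \<theta> j)) = ereal v"
  proof (rule antisym)
    show "(SUP j. ereal (besov_level \<alpha> p \<theta> j)) \<le> ereal v"
    proof (rule SUP_least)
      fix j show "ereal (besov_level \<alpha> p \<theta> j) \<le> ereal v"
        using v zero[of j] by (cases "j = J") auto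
    qed
    show "ereal v \<le> (SUP j. ereal (besov_level \<alpha> p \<theta> j))"
      using v(2) by (auto intro: SUP_upper2[of J])
  qed
  then show ?thesis using PInf by (simp add: besov_norm_def)
next
  case (real Q)
  then have Q: "1 < Q" using q by simp
  have eq: "(\<lambda>j. besov_level \<alpha> p \<theta> j powr Q) = (\<lambda>j. if j = J then v powr Q else 0)"
    using v zero by auto
  have "(\<lambda>j. besov_level \<alpha> p \<theta> j powr Q) sums (v powr Q)"
    unfolding eq using sums_single[of J "\<lambda>_. v powr Q"] by simp
  moreover have "(v powr Q) powr (1 / Q) = v" using Q v by (simp add: powr_powr)
  ultimately show ?thesis using real by (simp add: besov_norm_def sums_iff)
qed (use q in auto)

lemma level_norm_const:
  assumes p: "2 \<le> p" and v: "0 \<le> v" "\<And>k. k \<in> {1..2 ^ j} \<Longrightarrow> \<bar>\<theta> j k\<bar> = v"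
  shows "level_norm p \<theta> j = 2 powr (real j * real_of_ereal (1 / p)) * v"
proof (cases p)
  case PInf
  have "(\<lambda>k. \<bar>\<theta> j k\<bar>) ` {1..2 ^ j} = (\<lambda>k. v) ` {1..(2::nat) ^ j}" using v by (intro image_cong) auto
  also have "\<dots> = {v}" by (rule image_constant[of 1]) auto
  finally show ?thesis using PInf by (simp add: level_norm_def)
next
  case (real P)
  then have P: "2 \<le> P" using p by simp
  have "(\<Sum>k = 1..2 ^ j. \<bar>\<theta> j k\<bar> powr P) = (\<Sum>k = 1..(2::nat) ^ j. v powr P)" by (intro sum.cong) (auto simp: v)
  also have "\<dots> = 2 powr real j * v powr P" by (simp add: powr_realpow)
  finally have "level_norm p \<theta> j = (2 powr real j * v powr P) powr (1 / P)"
    using real by (simp add: level_norm_def)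
  also have "\<dots> = 2 powr (real j * (1 / P)) * v"
    using P v by (simp add: powr_mult powr_powr)
  finally show ?thesis using real P by (simp add: one_ereal_def)
qed (use p in auto)

text \<open>The factor \<open>2 powr (- J / p)\<close> in the weight cancels the number of equal coefficients, so the norm of
  a corner does not depend on \<open>p\<close>.\<close>
lemma besov_norm_corner:
  assumes p: "2 \<le> p" and q: "1 < q" and a: "0 \<le> a"
  shows "besov_norm \<alpha> p q (corner a J S) = ereal (a * (2 ^ J) powr (\<alpha> + 1 / 2))"
proof (rule besov_norm_single_level[OF q])
  show "besov_level \<alpha> p (corner a J S) J = a * (2 ^ J) powr (\<alpha> + 1 / 2)"
  proof -
    have "besov_level \<alpha> p (corner a J S) J = 2 powr (real J * (\<alpha> + 1 / 2 - real_of_ereal (1 / p))) * (2 powr (real J * real_of_ereal (1 / p)) * a)"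
      unfolding besov_level_def using a by (subst level_norm_const[OF p a]) (auto simp: corner_def)
    also have "\<dots> = a * 2 powr (real J * (\<alpha> + 1 / 2 - real_of_ereal (1 / p)) + real J * real_of_ereal (1 / p))"
      by (simp add: powr_add)
    also have "\<dots> = a * (2 powr real J) powr (\<alpha> + 1 / 2)"
      by (simp add: powr_powr algebra_simps)
    finally show ?thesis by (simp add: powr_realpow)
  qed
  fix j assume "j \<noteq> J"
  then show "besov_level \<alpha> p (corner a J S) j = 0"
    unfolding besov_level_def by (subst level_norm_const[OF p, of 0]) (auto simp: corner_def)
qed (use a in auto)

lemma ex_dyadic:
  fixes x :: real assumes "1 \<le> x" shows "\<exists>J. 2 ^ J \<le> x \<and> x < 2 * 2 ^ J"
proof -
  obtain n where "x < 2 ^ n" using real_arch_pow[of 2 x] by auto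
  then have "\<exists>n. x < 2 ^ n \<and> (\<forall>i<n. \<not> x < 2 ^ i)" by (rule exists_least_iff[THEN iffD1, OF exI])
  then obtain n where n: "x < 2 ^ n" "\<forall>i<n. \<not> x < 2 ^ i" by blast
  then obtain J where "n = Suc J" using assms by (cases n) auto
  then show ?thesis using n by (intro exI[of _ J]) auto
qed

section \<open>The two costs\<close>

text \<open>The assumptions on \<open>M\<close> say that the cube lies in the ball of radius \<open>M\<close> and that its dimension is, up to a factor
  of two, the largest possible. The risk budget of this ball, divided by \<open>2 ^ J\<close>, is then at most
  \<open>2 * C \<alpha> * a\<^sup>2 / \<delta> powr (4 * \<alpha> / (2 * \<alpha> + 1))\<close>, which a large \<open>\<delta>\<close> pushes below \<open>a\<^sup>2 / 2\<close>.\<close>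
lemma adaptive_risk_on_corners:
  fixes C :: "real \<Rightarrow> real" and p q :: ereal
  assumes e: "e \<in> adaptive_estimators m \<sigma> (full_parameter_set \<sigma>) C"
    and m: "1 \<le> m" and \<sigma>: "0 < \<sigma>" and \<delta>: "0 < \<delta>" and a: "a = \<delta> * \<sigma> / sqrt m"
    and \<alpha>: "0 < \<alpha>" and p: "2 \<le> p" and q: "1 < q" and C: "0 < C \<alpha>"
    and \<delta>C: "4 * C \<alpha> \<le> \<delta> powr (4 * \<alpha> / (2 * \<alpha> + 1))"
    and M: "\<sigma> \<le> M" "a * (2 ^ J) powr (\<alpha> + 1 / 2) \<le> M" "(M / a) powr (2 / (2 * \<alpha> + 1)) \<le> 2 * 2 ^ J"
  shows "risk m \<sigma> e (corner a J S) \<le> ennreal (a\<^sup>2 * 2 ^ J / 2)"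
proof -
  define D where "D = (2::real) ^ J"
  define b where "b = 2 * \<alpha> + 1"
  have pos: "0 < a" "0 < M" "0 < D" "1 < b" using m \<sigma> \<delta> \<alpha> M by (auto simp: a D_def b_def)
  have "corner a J S \<in> besov_ball \<alpha> M p q"
    using M(2) pos(1) by (simp add: besov_ball_def besov_norm_corner[OF p q])
  moreover have "(\<alpha>, M, p, q) \<in> full_parameter_set \<sigma>"
    using \<alpha> p q M by (simp add: full_parameter_set_def)
  ultimately have "risk m \<sigma> e (corner a J S) \<le> ennreal (C \<alpha> * M powr (2 / b) * (\<sigma>\<^sup>2 / m) powr (2 * \<alpha> / b))"
    using e unfolding adaptive_estimators_def b_def by (auto simp: SUP_le_iff)
  also have "\<dots> \<le> ennreal (a\<^sup>2 * D / 2)"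
  proof (rule ennreal_leI)
    have "\<sigma>\<^sup>2 / m = (a / \<delta>)\<^sup>2" using \<delta> m by (simp add: a power_divide)
    also have "\<dots> = (a / \<delta>) powr 2" using pos \<delta> by simp
    finally have s0: "\<sigma>\<^sup>2 / m = (a / \<delta>) powr 2" .
    have s: "(\<sigma>\<^sup>2 / m) powr (2 * \<alpha> / b) = a powr (4 * \<alpha> / b) / \<delta> powr (4 * \<alpha> / b)"
      unfolding s0 powr_powr using pos \<delta> by (simp add: powr_divide)
    have "M powr (2 / b) = (M / a) powr (2 / b) * a powr (2 / b)"
      using pos by (simp add: powr_divide)
    then have "M powr (2 / b) \<le> 2 * D * a powr (2 / b)"
      using M(3) by (simp add: mult_right_mono D_def b_def)
    then have "C \<alpha> * M powr (2 / b) * (\<sigma>\<^sup>2 / m) powr (2 * \<alpha> / b)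
      \<le> C \<alpha> * (2 * D * a powr (2 / b)) * (a powr (4 * \<alpha> / b) / \<delta> powr (4 * \<alpha> / b))"
      unfolding s using C by (intro mult_right_mono mult_left_mono) auto
    also have "\<dots> = C \<alpha> * (2 * D) * (a powr (2 / b) * a powr (4 * \<alpha> / b)) / \<delta> powr (4 * \<alpha> / b)"
      by simp
    also have "a powr (2 / b) * a powr (4 * \<alpha> / b) = a powr 2"
    proof -
      have "2 / b + 4 * \<alpha> / b = (2 + 4 * \<alpha>) / b" by (simp add: add_divide_distrib)
      also have "\<dots> = 2" using pos(4) by (simp add: b_def field_simps)
      finally show ?thesis by (simp add: powr_add[symmetric])
    qed
    also have "a powr 2 = a\<^sup>2" using pos by simp
    also have "C \<alpha> * (2 * D) * a\<^sup>2 / \<delta> powr (4 * \<alpha> / b) \<le> C \<alpha> * (2 * D) * a\<^sup>2 / (4 * C \<alpha>)"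
      using \<delta>C C pos \<delta> by (intro divide_left_mono) (auto simp: b_def)
    also have "\<dots> = a\<^sup>2 * D / 2" using C by simp
    finally show "C \<alpha> * M powr (2 / b) * (\<sigma>\<^sup>2 / m) powr (2 * \<alpha> / b) \<le> a\<^sup>2 * D / 2" .
  qed
  finally show ?thesis by (simp add: D_def)
qed

lemma adaptive_long_transcripts:
  fixes C :: "real \<Rightarrow> real" and p q :: ereal
  assumes e: "e \<in> adaptive_estimators m \<sigma> (full_parameter_set \<sigma>) C"
    and m: "1 \<le> m" and \<sigma>: "0 < \<sigma>" and \<delta>: "1 \<le> \<delta>" and a: "a = \<delta> * \<sigma> / sqrt m"
    and \<alpha>: "0 < \<alpha>" and p: "2 \<le> p" and q: "1 < q" and C: "0 < C \<alpha>"
    and \<delta>C: "4 * C \<alpha> \<le> \<delta> powr (4 * \<alpha> / (2 * \<alpha> + 1))"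
    and M: "\<sigma> \<le> M" "a * (2 ^ J) powr (\<alpha> + 1 / 2) \<le> M" "(M / a) powr (2 / (2 * \<alpha> + 1)) \<le> 2 * 2 ^ J"
    and K: "K = exp (4 * \<delta>\<^sup>2)" and D0: "D0 = 512 * K * \<delta>\<^sup>2" "D0 \<le> 2 ^ J"
  obtains T :: nat where "2 ^ J / (2 * D0) \<le> T"
    "2 ^ 2 ^ J * (m / (3072 * K ^ 6 * \<delta> ^ 4)) \<le>
      (\<Sum>S\<in>Pow {1..2 ^ J}. \<Sum>i = 1..m. long_prob \<sigma> (encoder e i) T (corner a J S))"
proof -
  define T where "T = nat \<lfloor>2 ^ J / D0\<rfloor>"
  have D0': "0 < D0" using \<delta> by (simp add: D0 K)
  have 1: "1 \<le> 2 ^ J / D0" using D0 D0' by simp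
  then have T1: "1 \<le> T" by (simp add: T_def le_nat_iff)
  have Tle: "T \<le> 2 ^ J / D0" using 1 unfolding T_def by (simp add: of_nat_nat)
  have "2 ^ J / D0 < real T + 1"
    unfolding T_def using 1 by (simp add: of_nat_nat)
  also have "\<dots> \<le> 2 * real T" using T1 by simp
  finally have Tge: "2 ^ J / (2 * D0) \<le> T" using D0' by (simp add: field_simps)
  have "256 * K * \<delta>\<^sup>2 * (real T + 1) \<le> 256 * K * \<delta>\<^sup>2 * (2 * real T)"
    using T1 by (intro mult_left_mono) (auto simp: K)
  also have "\<dots> = D0 * T" by (simp add: D0)
  also have "\<dots> \<le> 2 ^ J" using Tle D0' by (simp add: field_simps)
  finally have T: "256 * K * \<delta>\<^sup>2 * (real T + 1) \<le> 2 ^ J" .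
  have e': "e \<in> dist_estimators m" using e by (simp add: adaptive_estimators_def)
  show ?thesis
  proof (rule that[OF Tge])
    show "2 ^ 2 ^ J * (m / (3072 * K ^ 6 * \<delta> ^ 4)) \<le>
      (\<Sum>S\<in>Pow {1..2 ^ J}. \<Sum>i = 1..m. long_prob \<sigma> (encoder e i) T (corner a J S))"
    proof (rule long_transcripts[OF e' m \<sigma> _ a K T])
      show "0 < \<delta>" using \<delta> by simp
      show "risk m \<sigma> e (corner a J S) \<le> ennreal (a\<^sup>2 * 2 ^ J / 2)" for S
        by (rule adaptive_risk_on_corners[OF e m \<sigma> _ a \<alpha> p q C \<delta>C M]) (use \<delta> in simp)
    qed
  qed
qed

text \<open>The cube lies in the given ball itself, so some corner of it witnesses the cost. If the largest cube in the ball
  has bounded dimension, the claimed bound is of order \<open>m\<close>.\<close>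
lemma transmission_cost:
  fixes C :: "real \<Rightarrow> real" and p q :: ereal
  assumes \<alpha>: "0 < \<alpha>" and p: "2 \<le> p" and q: "1 < q" and C: "0 < C \<alpha>" and \<delta>: "1 \<le> \<delta>"
    and \<delta>C: "4 * C \<alpha> \<le> \<delta> powr (4 * \<alpha> / (2 * \<alpha> + 1))"
  shows "\<exists>c>0. \<forall>m \<sigma> M e. 1 \<le> m \<longrightarrow> 0 < \<sigma> \<longrightarrow> \<sigma> \<le> M \<longrightarrow>
    e \<in> adaptive_estimators m \<sigma> (full_parameter_set \<sigma>) C \<longrightarrow>
    ennreal (c * ((M / \<sigma>) powr (2 / (2 * \<alpha> + 1)) * real m powr ((2 * \<alpha> + 2) / (2 * \<alpha> + 1))))
      \<le> (SUP \<theta>\<in>besov_ball \<alpha> M p q. expected_cost m \<sigma> e \<theta>)"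
proof -
  define b where "b = 2 * \<alpha> + 1"
  define K where "K = exp (4 * \<delta>\<^sup>2)"
  define c1 where "c1 = 1 / (3072 * K ^ 6 * \<delta> ^ 4)"
  define D0 where "D0 = 512 * K * \<delta>\<^sup>2"
  define c2 where "c2 = min (c1 / (4 * D0)) (1 / (2 * D0))"
  define c where "c = c2 * \<delta> powr (- 2 / b)"
  have b: "1 < b" using \<alpha> by (simp add: b_def)
  have K1: "1 \<le> K" by (simp add: K_def)
  have pos: "0 < c1" "0 < D0" "0 < c2" "0 < c" using \<delta> by (auto simp: c1_def D0_def K_def c2_def c_def)
  have D01: "1 \<le> D0"
  proof -
    have "1 * 1 \<le> K * \<delta>\<^sup>2" using K1 \<delta> by (intro mult_mono) auto
    then show ?thesis by (simp add: D0_def)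
  qed
  show ?thesis
  proof (intro exI[of _ c] conjI allI impI)
    show "0 < c" by (rule pos)
    fix m :: nat and \<sigma> M :: real and e
    assume m: "1 \<le> m" and \<sigma>: "0 < \<sigma>" and M: "\<sigma> \<le> M"
      and e: "e \<in> adaptive_estimators m \<sigma> (full_parameter_set \<sigma>) C"
    have e': "e \<in> dist_estimators m" using e by (simp add: adaptive_estimators_def)
    define a where "a = \<delta> * \<sigma> / sqrt m"
    define X where "X = (M / a) powr (2 / b)"
    let ?sup = "SUP \<theta>\<in>besov_ball \<alpha> M p q. expected_cost m \<sigma> e \<theta>"
    have a: "0 < a" using m \<sigma> \<delta> by (simp add: a_def)
    have X0: "0 \<le> X" by (simp add: X_def)
    have cX: "c * ((M / \<sigma>) powr (2 / b) * real m powr ((2 * \<alpha> + 2) / b)) = c2 * X * m"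
    proof -
      have "M / a = (M / \<sigma>) * (m powr (1 / 2) / \<delta>)"
        using m \<sigma> \<delta> by (simp add: a_def powr_half_sqrt)
      then have "X = (M / \<sigma>) powr (2 / b) * ((m powr (1 / 2)) powr (2 / b) / \<delta> powr (2 / b))"
        unfolding X_def using M \<sigma> \<delta> m by (simp add: powr_mult powr_divide)
      also have "(m powr (1 / 2)) powr (2 / b) = m powr (1 / b)" by (simp add: powr_powr)
      finally have X: "X = (M / \<sigma>) powr (2 / b) * m powr (1 / b) * \<delta> powr (- 2 / b)"
        by (simp add: powr_minus field_simps)
      have "(2 * \<alpha> + 2) / b = 1 / b + 1" using b by (simp add: b_def field_simps)
      then have "real m powr ((2 * \<alpha> + 2) / b) = m powr (1 / b) * m" using m by (simp add: powr_add)
      then show ?thesis by (simp add: c_def X)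
    qed
    have "ennreal (c2 * X * m) \<le> ?sup"
    proof (cases "\<exists>J. 2 ^ J \<le> X \<and> X < 2 * 2 ^ J \<and> D0 \<le> 2 ^ J")
      case True
      then obtain J where J: "2 ^ J \<le> X" "X < 2 * 2 ^ J" "D0 \<le> 2 ^ J" by blast
      have "(2 ^ J) powr (b / 2) \<le> X powr (b / 2)" using J b by (intro powr_mono2) auto
      also have "\<dots> = M / a" using b a M \<sigma> by (simp add: X_def powr_powr)
      finally have ball: "a * (2 ^ J) powr (\<alpha> + 1 / 2) \<le> M"
        using a by (simp add: b_def field_simps)
      have Mp: "(M / a) powr (2 / (2 * \<alpha> + 1)) \<le> 2 * 2 ^ J" using J(2) by (simp add: X_def b_def)
      obtain T where T: "2 ^ J / (2 * D0) \<le> real T"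
        "2 ^ 2 ^ J * (m / (3072 * K ^ 6 * \<delta> ^ 4)) \<le> (\<Sum>S\<in>Pow {1..2 ^ J}. \<Sum>i = 1..m. long_prob \<sigma> (encoder e i) T (corner a J S))"
        by (rule adaptive_long_transcripts[OF e m \<sigma> \<delta> a_def \<alpha> p q C \<delta>C M ball Mp K_def D0_def J(3)])
      \<comment> \<open>Some corner reaches the average.\<close>
      have "\<exists>S\<in>Pow {1..2 ^ J}. m * c1 \<le> (\<Sum>i = 1..m. long_prob \<sigma> (encoder e i) T (corner a J S))"
      proof (rule ccontr)
        assume "\<not> ?thesis"
        then have "(\<Sum>S\<in>Pow {1..2 ^ J}. \<Sum>i = 1..m. long_prob \<sigma> (encoder e i) T (corner a J S)) < (\<Sum>S\<in>Pow {1..(2::nat) ^ J}. m * c1)"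
          by (intro sum_strict_mono) (auto simp: not_le)
        then show False using T(2) by (simp add: card_Pow c1_def)
      qed
      then obtain S where S: "m * c1 \<le> (\<Sum>i = 1..m. long_prob \<sigma> (encoder e i) T (corner a J S))" by blast
      have "c2 * X * m \<le> c1 / (4 * D0) * (2 * 2 ^ J) * m"
        using J X0 pos by (intro mult_right_mono mult_mono) (auto simp: c2_def)
      also have "\<dots> = 2 ^ J / (2 * D0) * (m * c1)" by simp
      also have "\<dots> \<le> T * (\<Sum>i = 1..m. long_prob \<sigma> (encoder e i) T (corner a J S))"
        using T(1) S pos by (intro mult_mono) auto
      finally have "ennreal (c2 * X * m) \<le> ennreal (T * (\<Sum>i = 1..m. long_prob \<sigma> (encoder e i) T (corner a J S)))"
        by (rule ennreal_leI)
      also have "\<dots> \<le> expected_cost m \<sigma> e (corner a J S)" by (rule expected_cost_ge[OF e' \<sigma>])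
      also have "\<dots> \<le> ?sup"
        using ball a by (intro SUP_upper) (simp add: besov_ball_def besov_norm_corner[OF p q])
      finally show ?thesis .
    next
      case False
      have "X \<le> 2 * D0"
      proof (cases "1 \<le> X")
        case True
        then obtain J where "2 ^ J \<le> X" "X < 2 * 2 ^ J" using ex_dyadic by blast
        then show ?thesis using False by force
      qed (use D01 in simp)
      then have "c2 * X * m \<le> 1 / (2 * D0) * (2 * D0) * m"
        using X0 pos by (intro mult_right_mono mult_mono) (auto simp: c2_def)
      then have "ennreal (c2 * X * m) \<le> ennreal m" using pos by (intro ennreal_leI) simp
      also have "\<dots> \<le> expected_cost m \<sigma> e (corner 0 0 {})" by (rule expected_cost_ge_machines[OF e' \<sigma>])
      also have "\<dots> \<le> ?sup"
        using M \<sigma> by (intro SUP_upper) (simp add: besov_ball_def besov_norm_corner[OF p q])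
      finally show ?thesis .
    qed
    then show "ennreal (c * ((M / \<sigma>) powr (2 / (2 * \<alpha> + 1)) * real m powr ((2 * \<alpha> + 2) / (2 * \<alpha> + 1)))) \<le> ?sup"
      unfolding cX[unfolded b_def] .
  qed
qed

text \<open>The estimator pays \<open>m ^ 3\<close> at the zero signal, because from its own data no machine can exclude a dense weak
  signal, possibly outside the given ball, which the estimator must recover as well.\<close>
lemma adaptation_cost:
  fixes C :: "real \<Rightarrow> real" and p q :: ereal
  assumes \<alpha>: "0 < \<alpha>" and p: "2 \<le> p" and q: "1 < q" and C: "0 < C \<alpha>" and \<delta>: "1 \<le> \<delta>"
    and \<delta>C: "4 * C \<alpha> \<le> \<delta> powr (4 * \<alpha> / (2 * \<alpha> + 1))"
  shows "\<exists>c>0. \<forall>m \<sigma> e. 1 \<le> m \<longrightarrow> 0 < \<sigma> \<longrightarrow>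
    e \<in> adaptive_estimators m \<sigma> (full_parameter_set \<sigma>) C \<longrightarrow>
    ennreal (c * real m ^ 3) \<le> expected_cost m \<sigma> e (\<lambda>_ _. 0)"
proof -
  define K where "K = exp (4 * \<delta>\<^sup>2)"
  define c1 where "c1 = 1 / (3072 * K ^ 6 * \<delta> ^ 4)"
  define D0 where "D0 = 512 * K * \<delta>\<^sup>2"
  \<comment> \<open>For a cube of dimension at most \<open>\<epsilon> * m\<^sup>2\<close>, passing from the mixture to the zero signal lowers the probability
    of a long transcript by at most \<open>c1 / 2\<close>; beyond \<open>m0\<close> such a cube exists, and the ball that contains
    it has radius at least \<open>\<sigma>\<close>.\<close>
  define \<epsilon> where "\<epsilon> = c1\<^sup>2 / (8 * \<delta> ^ 4)"
  define m0 where "m0 = max (\<delta>\<^sup>2) (2 * D0 / \<epsilon>)"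
  define c where "c = min (c1 * \<epsilon> / (8 * D0)) (1 / m0\<^sup>2)"
  have K1: "1 \<le> K" by (simp add: K_def)
  have \<delta>4: "1 \<le> \<delta> ^ 4" "1 \<le> K ^ 6" "1 \<le> \<delta>\<^sup>2" using \<delta> K1 by auto
  have D01: "1 \<le> D0"
  proof -
    have "1 * 1 \<le> K * \<delta>\<^sup>2" using K1 \<delta> by (intro mult_mono) auto
    then show ?thesis by (simp add: D0_def)
  qed
  have c1: "0 < c1" "c1 \<le> 1"
  proof -
    have "1 * 1 \<le> K ^ 6 * \<delta> ^ 4" using \<delta>4 by (intro mult_mono) auto
    then show "c1 \<le> 1" "0 < c1" by (auto simp: c1_def)
  qed
  have \<epsilon>: "0 < \<epsilon>" "\<epsilon> * \<delta> ^ 4 = c1\<^sup>2 / 8" using c1 \<delta> by (auto simp: \<epsilon>_def)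
  have m0: "1 \<le> m0" using \<delta>4 by (simp add: m0_def)
  have c: "0 < c" using c1 \<epsilon> D01 m0 by (auto simp: c_def)
  show ?thesis
  proof (intro exI[of _ c] conjI allI impI)
    show "0 < c" by (rule c)
    fix m :: nat and \<sigma> :: real and e
    assume m: "1 \<le> m" and \<sigma>: "0 < \<sigma>" and e: "e \<in> adaptive_estimators m \<sigma> (full_parameter_set \<sigma>) C"
    have e': "e \<in> dist_estimators m" using e by (simp add: adaptive_estimators_def)
    show "ennreal (c * real m ^ 3) \<le> expected_cost m \<sigma> e (\<lambda>_ _. 0)"
    proof (cases "m \<le> m0")
      case True
      have "c * real m ^ 3 = c * (real m)\<^sup>2 * m" by (simp add: power2_eq_square power3_eq_cube)
      also have "\<dots> \<le> 1 / m0\<^sup>2 * m0\<^sup>2 * m"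
        using True m0 c by (intro mult_right_mono mult_mono power_mono) (auto simp: c_def)
      also have "\<dots> = m" using m0 by simp
      finally have "ennreal (c * real m ^ 3) \<le> ennreal m" by (rule ennreal_leI)
      also have "\<dots> \<le> expected_cost m \<sigma> e (\<lambda>_ _. 0)" by (rule expected_cost_ge_machines[OF e' \<sigma>])
      finally show ?thesis .
    next
      case False
      then have mm: "\<delta>\<^sup>2 \<le> m" "2 * D0 / \<epsilon> \<le> m" by (auto simp: m0_def)
      then have "2 * D0 \<le> \<epsilon> * m" using \<epsilon> by (simp add: field_simps)
      then have "2 * D0 * m \<le> \<epsilon> * m * m" by (intro mult_right_mono) auto
      then have \<epsilon>m: "2 * D0 * m \<le> \<epsilon> * (real m)\<^sup>2" by (simp add: power2_eq_square)
      have D0m: "D0 \<le> D0 * m" "real m \<le> D0 * m" using m D01 by (auto simp: mult_le_cancel_left1 mult_le_cancel_right1)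
      then have "1 \<le> \<epsilon> * (real m)\<^sup>2" using \<epsilon>m D01 by linarith
      then obtain J where J: "2 ^ J \<le> \<epsilon> * (real m)\<^sup>2" "\<epsilon> * (real m)\<^sup>2 < 2 * 2 ^ J" using ex_dyadic by blast
      have DJ: "D0 \<le> 2 ^ J" "real m \<le> 2 ^ J" using J \<epsilon>m D0m by linarith+
      define a where "a = \<delta> * \<sigma> / sqrt m"
      \<comment> \<open>The radius of the smallest ball that contains the cube.\<close>
      define M where "M = a * (2 ^ J) powr (\<alpha> + 1 / 2)"
      have a: "0 < a" using m \<sigma> \<delta> by (simp add: a_def)
      have "sqrt m * 1 \<le> sqrt (2 ^ J) * \<delta>" using DJ \<delta> by (intro mult_mono) auto
      also have "sqrt (2 ^ J) = (2 ^ J) powr (1 / 2)" by (simp add: powr_half_sqrt)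
      also have "\<dots> \<le> (2 ^ J) powr (\<alpha> + 1 / 2)" using \<alpha> by (intro powr_mono) auto
      finally have "sqrt m \<le> (2 ^ J) powr (\<alpha> + 1 / 2) * \<delta>" using \<delta> by (simp add: mult_right_mono)
      then have "sqrt m * \<sigma> \<le> (2 ^ J) powr (\<alpha> + 1 / 2) * \<delta> * \<sigma>" using \<sigma> by (intro mult_right_mono) auto
      then have M: "\<sigma> \<le> M" using m by (simp add: M_def a_def field_simps)
      have "(M / a) powr (2 / (2 * \<alpha> + 1)) = 2 ^ J"
      proof -
        have "(\<alpha> + 1 / 2) * (2 / (2 * \<alpha> + 1)) = 1" using \<alpha> by (simp add: field_simps)
        moreover have "M / a = (2 ^ J) powr (\<alpha> + 1 / 2)" using a by (simp add: M_def)
        ultimately show ?thesis by (simp only: powr_powr) simp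
      qed
      then have Mp: "(M / a) powr (2 / (2 * \<alpha> + 1)) \<le> 2 * 2 ^ J" by simp
      obtain T where T: "2 ^ J / (2 * D0) \<le> real T"
        "2 ^ 2 ^ J * (m / (3072 * K ^ 6 * \<delta> ^ 4)) \<le> (\<Sum>S\<in>Pow {1..2 ^ J}. \<Sum>i = 1..m. long_prob \<sigma> (encoder e i) T (corner a J S))"
        by (rule adaptive_long_transcripts[OF e m \<sigma> \<delta> a_def \<alpha> p q C \<delta>C M _ Mp K_def D0_def DJ(1)])
          (simp_all add: M_def)
      define \<rho> where "\<rho> = a\<^sup>2 / \<sigma>\<^sup>2"
      have \<rho>: "\<rho> = \<delta>\<^sup>2 / m" using \<sigma> m by (simp add: \<rho>_def a_def power_divide power_mult_distrib)
      have \<rho>1: "\<rho> \<le> 1" using mm m by (simp add: \<rho>)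
      define \<eta> where "\<eta> = 2 ^ J * \<rho>\<^sup>2"
      have "\<eta> \<le> \<epsilon> * (real m)\<^sup>2 * \<rho>\<^sup>2" unfolding \<eta>_def using J by (intro mult_right_mono) auto
      also have "\<dots> = c1\<^sup>2 / 8" unfolding \<epsilon>(2)[symmetric] using m by (simp add: \<rho> power_divide power2_eq_square power4_eq_xxxx)
      finally have \<eta>: "\<eta> \<le> c1\<^sup>2 / 8" .
      have "c1\<^sup>2 \<le> 1" using c1 by (simp add: power_le_one)
      then have \<eta>1: "0 \<le> \<eta>" "\<eta> \<le> 1" using \<eta> by (auto simp: \<eta>_def)
      have "\<eta>\<^sup>2 \<le> \<eta>" using \<eta>1 by (simp add: power2_eq_square mult_left_le_one_le)
      then have "exp \<eta> - 1 \<le> c1\<^sup>2 / 4" using exp_le_quadratic[OF \<eta>1(2)] \<eta> by simp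
      then have "(exp \<eta> - 1) / (4 * (c1 / 4)) \<le> (c1\<^sup>2 / 4) / (4 * (c1 / 4))" using c1 by (intro divide_right_mono) auto
      also have "\<dots> = c1 / 4" using c1 by (simp add: power2_eq_square)
      finally have chi: "(exp \<eta> - 1) / (4 * (c1 / 4)) \<le> c1 / 4" .
      have c14: "0 < c1 / 4" using c1 by simp
      have "m * c1 \<le> (\<Sum>S\<in>Pow {1..2 ^ J}. \<Sum>i = 1..m. long_prob \<sigma> (encoder e i) T (corner a J S)) / 2 ^ 2 ^ J"
        using T(2) unfolding c1_def by (subst pos_le_divide_eq) (simp_all add: mult_ac)
      also have "\<dots> = (\<Sum>i = 1..m. (\<Sum>S\<in>Pow {1..2 ^ J}. long_prob \<sigma> (encoder e i) T (corner a J S)) / 2 ^ 2 ^ J)"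
        by (subst sum.swap) (simp add: sum_divide_distrib)
      also have "\<dots> \<le> (\<Sum>i = 1..m. long_prob \<sigma> (encoder e i) T (\<lambda>_ _. 0) + c1 / 2)"
      proof (rule sum_mono)
        fix i assume i: "i \<in> {1..m}"
        show "(\<Sum>S\<in>Pow {1..2 ^ J}. long_prob \<sigma> (encoder e i) T (corner a J S)) / 2 ^ 2 ^ J
          \<le> long_prob \<sigma> (encoder e i) T (\<lambda>_ _. 0) + c1 / 2"
          using mixture_long_prob_le[OF dist_estimatorsD[OF e' i] \<sigma> \<rho>_def \<rho>1 c14, of T J] chi
          unfolding \<eta>_def by linarith
      qed
      also have "\<dots> = (\<Sum>i = 1..m. long_prob \<sigma> (encoder e i) T (\<lambda>_ _. 0)) + m * (c1 / 2)"
        by (simp add: sum.distrib)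
      finally have L: "m * (c1 / 2) \<le> (\<Sum>i = 1..m. long_prob \<sigma> (encoder e i) T (\<lambda>_ _. 0))" by simp
      have "c * real m ^ 3 \<le> c1 * \<epsilon> / (8 * D0) * real m ^ 3" by (intro mult_right_mono) (auto simp: c_def)
      also have "\<dots> = (\<epsilon> * (real m)\<^sup>2) / (4 * D0) * (m * (c1 / 2))" by (simp add: power2_eq_square power3_eq_cube)
      also have "\<dots> \<le> (2 * 2 ^ J) / (4 * D0) * (m * (c1 / 2))"
        using J c1 D01 by (intro mult_right_mono divide_right_mono) auto
      also have "\<dots> = 2 ^ J / (2 * D0) * (m * (c1 / 2))" by simp
      also have "\<dots> \<le> T * (\<Sum>i = 1..m. long_prob \<sigma> (encoder e i) T (\<lambda>_ _. 0))"
        using T(1) L c1 by (intro mult_mono) auto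
      finally have "ennreal (c * real m ^ 3) \<le> ennreal (T * (\<Sum>i = 1..m. long_prob \<sigma> (encoder e i) T (\<lambda>_ _. 0)))"
        by (rule ennreal_leI)
      also have "\<dots> \<le> expected_cost m \<sigma> e (\<lambda>_ _. 0)" by (rule expected_cost_ge[OF e' \<sigma>])
      finally show ?thesis .
    qed
  qed
qed

theorem theorem5:
  fixes C :: "real \<Rightarrow> real" and \<alpha> :: real and p q :: ereal
  assumes "\<And>a. 0 < a \<Longrightarrow> 0 < C a"
    and "0 < \<alpha>" and "2 \<le> p" and "1 < q"
  shows "\<exists>c>0. \<forall>m::nat. \<forall>\<sigma> M :: real. 1 \<le> m \<longrightarrow> 0 < \<sigma> \<longrightarrow> \<sigma> \<le> M \<longrightarrow>
    minimax_cost m \<sigma> (full_parameter_set \<sigma>) C (besov_ball \<alpha> M p q)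
      \<ge> ennreal (c * (real m ^ 3
           + (M / \<sigma>) powr (2 / (2 * \<alpha> + 1)) * real m powr ((2 * \<alpha> + 2) / (2 * \<alpha> + 1))))"
proof -
  have C: "0 < C \<alpha>" using assms by simp
  define \<gamma> where "\<gamma> = 4 * \<alpha> / (2 * \<alpha> + 1)"
  define \<delta> where "\<delta> = max 1 ((4 * C \<alpha>) powr (1 / \<gamma>))"
  have \<gamma>: "0 < \<gamma>" using assms(2) by (simp add: \<gamma>_def)
  have \<delta>: "1 \<le> \<delta>" by (simp add: \<delta>_def)
  have "4 * C \<alpha> = ((4 * C \<alpha>) powr (1 / \<gamma>)) powr \<gamma>" using \<gamma> C by (simp add: powr_powr)
  also have "\<dots> \<le> \<delta> powr \<gamma>" using \<gamma> by (intro powr_mono2) (auto simp: \<delta>_def)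
  finally have \<delta>C: "4 * C \<alpha> \<le> \<delta> powr (4 * \<alpha> / (2 * \<alpha> + 1))" by (simp add: \<gamma>_def)
  obtain c where c: "0 < c" and cost1: "\<And>m \<sigma> e. 1 \<le> m \<Longrightarrow> 0 < \<sigma> \<Longrightarrow>
      e \<in> adaptive_estimators m \<sigma> (full_parameter_set \<sigma>) C \<Longrightarrow>
      ennreal (c * real m ^ 3) \<le> expected_cost m \<sigma> e (\<lambda>_ _. 0)"
    using adaptation_cost[of \<alpha> p q C \<delta>, OF assms(2-4) C \<delta> \<delta>C] by blast
  obtain c' where c': "0 < c'" and cost2: "\<And>m \<sigma> M e. 1 \<le> m \<Longrightarrow> 0 < \<sigma> \<Longrightarrow> \<sigma> \<le> M \<Longrightarrow>
      e \<in> adaptive_estimators m \<sigma> (full_parameter_set \<sigma>) C \<Longrightarrow>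
      ennreal (c' * ((M / \<sigma>) powr (2 / (2 * \<alpha> + 1)) * real m powr ((2 * \<alpha> + 2) / (2 * \<alpha> + 1))))
        \<le> (SUP \<theta>\<in>besov_ball \<alpha> M p q. expected_cost m \<sigma> e \<theta>)"
    using transmission_cost[of \<alpha> p q C \<delta>, OF assms(2-4) C \<delta> \<delta>C] by blast
  show ?thesis
  proof (intro exI[of _ "min c c' / 2"] conjI allI impI)
    show "0 < min c c' / 2" using c c' by simp
    fix m :: nat and \<sigma> M :: real
    assume m: "1 \<le> m" and \<sigma>: "0 < \<sigma>" and M: "\<sigma> \<le> M"
    define Y where "Y = (M / \<sigma>) powr (2 / (2 * \<alpha> + 1)) * real m powr ((2 * \<alpha> + 2) / (2 * \<alpha> + 1))"
    have Y: "0 \<le> Y" by (simp add: Y_def)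
    have "ennreal (min c c' / 2 * (real m ^ 3 + Y)) \<le> (SUP \<theta>\<in>besov_ball \<alpha> M p q. expected_cost m \<sigma> e \<theta>)"
      if e: "e \<in> adaptive_estimators m \<sigma> (full_parameter_set \<sigma>) C" for e
    proof -
      have "corner 0 0 {} = (\<lambda>_ _. 0)" by (intro ext) (simp add: corner_def)
      then have "(\<lambda>_ _. 0) \<in> besov_ball \<alpha> M p q"
        using besov_norm_corner[OF assms(3,4), of 0 \<alpha> 0 "{}"] M \<sigma> by (simp add: besov_ball_def)
      then have zero: "ennreal (c * real m ^ 3) \<le> (SUP \<theta>\<in>besov_ball \<alpha> M p q. expected_cost m \<sigma> e \<theta>)"
        by (intro order_trans[OF cost1[OF m \<sigma> e]] SUP_upper)
      have "min c c' / 2 * (real m ^ 3 + Y) \<le> max (c * real m ^ 3) (c' * Y)"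
      proof -
        have "min c c' * real m ^ 3 \<le> c * real m ^ 3" "min c c' * Y \<le> c' * Y"
          using Y by (auto intro!: mult_right_mono)
        then show ?thesis by (simp add: algebra_simps max_def)
      qed
      then consider "min c c' / 2 * (real m ^ 3 + Y) \<le> c * real m ^ 3" | "min c c' / 2 * (real m ^ 3 + Y) \<le> c' * Y"
        by linarith
      then show ?thesis
      proof cases
        case 1
        show ?thesis by (rule order_trans[OF ennreal_leI[OF 1] zero])
      next
        case 2
        show ?thesis by (rule order_trans[OF ennreal_leI[OF 2] cost2[OF m \<sigma> M e, folded Y_def]])
      qed
    qed
    then show "ennreal (min c c' / 2 * (real m ^ 3
           + (M / \<sigma>) powr (2 / (2 * \<alpha> + 1)) * real m powr ((2 * \<alpha> + 2) / (2 * \<alpha> + 1))))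
      \<le> minimax_cost m \<sigma> (full_parameter_set \<sigma>) C (besov_ball \<alpha> M p q)"
      unfolding minimax_cost_def Y_def by (intro INF_greatest)
  qed
qed

end
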